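(* Let $\{X^{(a)}_t:t\ge 0\}$, $a>0$, be a family of Lévy processes with $\mu^{(a)}:=\mathbb{E}X^{(a)}_1<0$ for each $a>0$ and $\mu^{(a)}\uparrow 0$ as $a\downarrow 0$. Assume that there exist functions $d,\Delta:(0,\infty)\to(0,\infty)$ such that the following conditions hold: (I) $d(a)\,\Delta(a)\,|\mu^{(a)}|\to\beta$ as $a\downarrow0$, for some $\beta\in(0,\infty)$; (II) $\Delta(a)\{X^{(a)}_{d(a)t}-t\,d(a)\mu^{(a)}:t\ge 0\}\xrightarrow{d}\{X_t:t\ge 0\}$ in $D[0,\infty)$ as $a\downarrow0$, where $X$ is a Lévy process; (III) the family $\{\Delta(a)\sup_{t\ge0}X^{(a)}_t:a>0\}$ is tight. Then $$\Delta(a)\,\sup_{t\ge 0}X^{(a)}_t\xrightarrow{d}\sup_{t\ge 0}\left(X_t-\beta t\right)\quad\text{as } a\downarrow 0.$$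
   Context: A Lévy process is a real-valued process with $X_0=0$, stationary independent increments (with respect to a standard filtration) and càdlàg paths; all Lévy processes considered (including the limit $X$) are nondeterministic, i.e. $\sigma^2+\nu(\mathbb{R}\setminus\{0\})>0$, where $\sigma^2$ is the Gaussian coefficient and $\nu$ the Lévy measure. $D[0,\infty)$ is the space of real-valued càdlàg functions on $[0,\infty)$ with the Skorokhod $J_1$ topology. $\xrightarrow{d}$ denotes convergence in distribution (weak convergence). *)

theory Defs
  imports "HOL-Probability.Probability"
begin

section \<open>The Skorokhod space on the half-line\<close>

definition is_cadlag :: "(real \<Rightarrow> real) \<Rightarrow> bool" where
  "is_cadlag x \<longleftrightarrow>
     (\<forall>t\<ge>0. (x \<longlongrightarrow> x t) (at_right t)) \<and>
     (\<forall>t>0. \<exists>l. (x \<longlongrightarrow> l) (at_left t))"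

text \<open>Only the values on the half-line matter; setting the other values to \<open>0\<close> makes an element
  of this type the same thing as a cadlag function on the half-line.\<close>

typedef cadlag = "{x :: real \<Rightarrow> real. is_cadlag x \<and> (\<forall>t<0. x t = 0)}"
  morphisms path Abs_cadlag
  by (rule exI[of _ "\<lambda>_. 0"]) (auto simp: is_cadlag_def)

text \<open>The element of \<open>D[0,\<infinity>)\<close> given by a function; meaningful only if \<open>is_cadlag x\<close>.\<close>

definition cadlag_of :: "(real \<Rightarrow> real) \<Rightarrow> cadlag" where
  "cadlag_of x = Abs_cadlag (\<lambda>t. if t < 0 then 0 else x t)"

lemma is_cadlag_cut:
  assumes "is_cadlag x"
  shows "is_cadlag (\<lambda>t. if t < 0 then 0 else x t)"
  unfolding is_cadlag_def
proof (intro conjI allI impI)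
  fix t :: real assume t: "t \<ge> 0"
  have "(x \<longlongrightarrow> x t) (at_right t)" using assms t by (auto simp: is_cadlag_def)
  moreover have "eventually (\<lambda>s. x s = (if s < 0 then 0 else x s)) (at_right t)"
    using eventually_at_right_less[of t] by eventually_elim (use t in auto)
  ultimately show "((\<lambda>t. if t < 0 then 0 else x t) \<longlongrightarrow> (if t < 0 then 0 else x t)) (at_right t)"
    using t by (auto intro: Lim_transform_eventually)
next
  fix t :: real assume t: "t > 0"
  obtain l where "(x \<longlongrightarrow> l) (at_left t)" using assms t by (auto simp: is_cadlag_def)
  moreover have "eventually (\<lambda>s. x s = (if s < 0 then 0 else x s)) (at_left t)"
    using eventually_at_left_real[OF t] by eventually_elim auto
  ultimately have "((\<lambda>t. if t < 0 then 0 else x t) \<longlongrightarrow> l) (at_left t)"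
    by (rule Lim_transform_eventually)
  then show "\<exists>l. ((\<lambda>t. if t < 0 then 0 else x t) \<longlongrightarrow> l) (at_left t)" ..
qed

lemma path_cadlag_of: "is_cadlag x \<Longrightarrow> path (cadlag_of x) = (\<lambda>t. if t < 0 then 0 else x t)"
  unfolding cadlag_of_def by (subst Abs_cadlag_inverse) (auto intro: is_cadlag_cut)

text \<open>Increasing bijections of the half-line; they are automatically continuous.\<close>

definition time_changes :: "(real \<Rightarrow> real) set" where
  "time_changes = {\<tau>. bij_betw \<tau> {0..} {0..} \<and> strict_mono_on {0..} \<tau>}"

text \<open>The sets below form a neighbourhood base at \<open>x\<close> for the Skorokhod \<open>J\<^sub>1\<close> topology on
  \<open>D[0,\<infinity>)\<close>: a sequence \<open>x\<^sub>n\<close> is eventually in each of them iff there are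
  time changes \<open>\<tau>\<^sub>n\<close> with \<open>sup\<^bsub>t \<ge> 0\<^esub> \<bar>\<tau>\<^sub>n t - t\<bar> \<longlonglongrightarrow> 0\<close> and
  \<open>sup\<^bsub>t \<le> T\<^esub> \<bar>x\<^sub>n (\<tau>\<^sub>n t) - x t\<bar> \<longlonglongrightarrow> 0\<close> for every \<open>T\<close>, which is the usual
  description of \<open>J\<^sub>1\<close> convergence (Jacod and Shiryaev, Theorem VI.1.14).\<close>

definition J1_nbhd :: "cadlag \<Rightarrow> real \<Rightarrow> real \<Rightarrow> cadlag set" where
  "J1_nbhd x T \<epsilon> =
     {y. \<exists>\<tau>\<in>time_changes.
           (\<forall>t\<ge>0. \<bar>\<tau> t - t\<bar> \<le> \<epsilon>) \<and>
           (\<forall>t\<in>{0..T}. \<bar>path y (\<tau> t) - path x t\<bar> \<le> \<epsilon>)}"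

lemma J1_nbhd_mono: "T' \<le> T \<Longrightarrow> \<epsilon> \<le> \<epsilon>' \<Longrightarrow> J1_nbhd x T \<epsilon> \<subseteq> J1_nbhd x T' \<epsilon>'"
proof
  fix y assume le: "T' \<le> T" "\<epsilon> \<le> \<epsilon>'" and "y \<in> J1_nbhd x T \<epsilon>"
  then obtain \<tau> where "\<tau> \<in> time_changes" "\<forall>t\<ge>0. \<bar>\<tau> t - t\<bar> \<le> \<epsilon>"
    "\<forall>t\<in>{0..T}. \<bar>path y (\<tau> t) - path x t\<bar> \<le> \<epsilon>"
    unfolding J1_nbhd_def by blast
  moreover from this le have "\<forall>t\<ge>0. \<bar>\<tau> t - t\<bar> \<le> \<epsilon>'"
    "\<forall>t\<in>{0..T'}. \<bar>path y (\<tau> t) - path x t\<bar> \<le> \<epsilon>'"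
    by (meson order_trans, meson atLeastAtMost_iff order_trans)
  ultimately show "y \<in> J1_nbhd x T' \<epsilon>'"
    unfolding J1_nbhd_def by blast
qed

instantiation cadlag :: topological_space
begin

definition open_cadlag :: "cadlag set \<Rightarrow> bool" where
  "open_cadlag U \<longleftrightarrow> (\<forall>x\<in>U. \<exists>T. \<exists>\<epsilon>>0. J1_nbhd x T \<epsilon> \<subseteq> U)"

instance
proof
  show "open (UNIV :: cadlag set)"
    unfolding open_cadlag_def by (auto intro: exI[of _ 1])
next
  fix S T :: "cadlag set"
  assume S: "open S" and T: "open T"
  show "open (S \<inter> T)"
    unfolding open_cadlag_def
  proof
    fix x assume x: "x \<in> S \<inter> T"
    obtain t1 e1 where 1: "e1 > 0" "J1_nbhd x t1 e1 \<subseteq> S"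
      using S x unfolding open_cadlag_def by blast
    obtain t2 e2 where 2: "e2 > 0" "J1_nbhd x t2 e2 \<subseteq> T"
      using T x unfolding open_cadlag_def by blast
    have "J1_nbhd x (max t1 t2) (min e1 e2) \<subseteq> S \<inter> T"
      using 1 2 J1_nbhd_mono[of t1 "max t1 t2" "min e1 e2" e1 x]
        J1_nbhd_mono[of t2 "max t1 t2" "min e1 e2" e2 x] by auto
    then show "\<exists>t. \<exists>\<epsilon>>0. J1_nbhd x t \<epsilon> \<subseteq> S \<inter> T"
      using 1 2 by (intro exI[of _ "max t1 t2"] exI[of _ "min e1 e2"]) auto
  qed
next
  fix K :: "cadlag set set"
  assume "\<forall>S\<in>K. open S"
  then show "open (\<Union>K)"
    unfolding open_cadlag_def by (meson Union_iff Union_upper order_trans)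
qed

end

section \<open>Levy processes\<close>

text \<open>The usual conditions: a complete, right-continuous filtration on a complete probability
  space. The times are the nonnegative reals, whence \<open>max 0\<close>.\<close>

definition standard_filtration :: "'a measure \<Rightarrow> (real \<Rightarrow> 'a measure) \<Rightarrow> bool" where
  "standard_filtration M F \<longleftrightarrow>
     prob_space M \<and> complete_measure M \<and>
     filtration (space M) (\<lambda>t. F (max 0 t)) \<and>
     (\<forall>t\<ge>0. sets (F t) \<subseteq> sets M) \<and>
     null_sets M \<subseteq> sets (F 0) \<and>
     (\<forall>t\<ge>0. (\<Inter>s\<in>{t<..}. sets (F s)) = sets (F t))"

definition levy_process ::
  "'a measure \<Rightarrow> (real \<Rightarrow> 'a measure) \<Rightarrow> (real \<Rightarrow> 'a \<Rightarrow> real) \<Rightarrow> bool" where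
  "levy_process M F X \<longleftrightarrow>
     standard_filtration M F \<and>
     (\<forall>t\<ge>0. X t \<in> borel_measurable (F t)) \<and>
     (\<forall>\<omega>\<in>space M. X 0 \<omega> = 0) \<and>
     (\<forall>\<omega>\<in>space M. is_cadlag (\<lambda>t. X t \<omega>)) \<and>
     (\<forall>s t. 0 \<le> s \<and> s \<le> t \<longrightarrow>
        prob_space.indep_set M (sets (F s))
          {(\<lambda>\<omega>. X t \<omega> - X s \<omega>) -` B \<inter> space M | B. B \<in> sets borel} \<and>
        distr M borel (\<lambda>\<omega>. X t \<omega> - X s \<omega>) = distr M borel (X (t - s)))"

definition levy_measure :: "real measure \<Rightarrow> bool" where
  "levy_measure \<nu> \<longleftrightarrow>
     sets \<nu> = sets borel \<and> emeasure \<nu> {0} = 0 \<and> (\<integral>\<^sup>+x. ennreal (min 1 (x\<^sup>2)) \<partial>\<nu>) < \<infinity>"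

definition levy_exponent :: "real \<Rightarrow> real \<Rightarrow> real measure \<Rightarrow> real \<Rightarrow> complex" where
  "levy_exponent b \<sigma>2 \<nu> u =
     \<i> * of_real (b * u) - of_real (\<sigma>2 * u\<^sup>2 / 2) +
     (CLINT x|\<nu>. iexp (u * x) - 1 - \<i> * of_real (u * x * indicator {-1..1} x))"

definition levy_triplet ::
  "'a measure \<Rightarrow> (real \<Rightarrow> 'a \<Rightarrow> real) \<Rightarrow> real \<Rightarrow> real \<Rightarrow> real measure \<Rightarrow> bool" where
  "levy_triplet M X b \<sigma>2 \<nu> \<longleftrightarrow>
     0 \<le> \<sigma>2 \<and> levy_measure \<nu> \<and>
     (\<forall>t\<ge>0. \<forall>u. char (distr M borel (X t)) u = exp (of_real t * levy_exponent b \<sigma>2 \<nu> u))"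

text \<open>Every Levy process has exactly one triplet, by the Levy-Khintchine theorem, so the
  existential quantifier merely names its Gaussian coefficient and its Levy measure.\<close>

definition nondeterministic :: "'a measure \<Rightarrow> (real \<Rightarrow> 'a \<Rightarrow> real) \<Rightarrow> bool" where
  "nondeterministic M X \<longleftrightarrow>
     (\<exists>b \<sigma>2 \<nu>. levy_triplet M X b \<sigma>2 \<nu> \<and> ennreal \<sigma>2 + emeasure \<nu> (UNIV - {0}) > 0)"

section \<open>Convergence in distribution and tightness\<close>

text \<open>The random elements may live on different probability spaces, and the index
  runs along an arbitrary filter.\<close>

definition conv_in_dist ::
  "('i \<Rightarrow> 'a measure) \<Rightarrow> ('i \<Rightarrow> 'a \<Rightarrow> 'c::topological_space) \<Rightarrow>
   'b measure \<Rightarrow> ('b \<Rightarrow> 'c) \<Rightarrow> 'i filter \<Rightarrow> bool" where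
  "conv_in_dist M Y N Z G \<longleftrightarrow>
     (\<forall>\<^sub>F i in G. Y i \<in> borel_measurable (M i)) \<and> Z \<in> borel_measurable N \<and>
     (\<forall>f::'c \<Rightarrow> real. continuous_on UNIV f \<and> bounded (range f) \<longrightarrow>
        ((\<lambda>i. \<integral>\<omega>. f (Y i \<omega>) \<partial>M i) \<longlongrightarrow> (\<integral>\<omega>. f (Z \<omega>) \<partial>N)) G)"

text \<open>Tightness on the real line. The variables are extended-real valued because suprema are;
  the bound \<open>K\<close> is real, so a tight family is almost surely finite.\<close>

definition tight_family ::
  "'i set \<Rightarrow> ('i \<Rightarrow> 'a measure) \<Rightarrow> ('i \<Rightarrow> 'a \<Rightarrow> ereal) \<Rightarrow> bool" where
  "tight_family I M Y \<longleftrightarrow>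
     (\<forall>\<epsilon>>0. \<exists>K::real. \<forall>i\<in>I. measure (M i) {\<omega> \<in> space (M i). \<bar>Y i \<omega>\<bar> \<le> ereal K} \<ge> 1 - \<epsilon>)"

end

theory Submission
  imports Defs
begin

text \<open>Write \<open>p a t = \<Delta> a * X a (d a * t)\<close> and \<open>q t = Z t - \<beta> * t\<close>. By \<open>I\<close> and \<open>II\<close>, the processes \<open>p a\<close>
  converge to \<open>q\<close>, and the claim is that their all-time suprema converge too. Suprema over a bounded time
  window do so by continuity of a suitable functional on the Skorokhod space
  (\<open>continuous_on_trunc_sup_path\<close>, \<open>conv_in_dist_trunc_sup\<close>). What remains is to show that a late
  excursion above \<open>0\<close> is unlikely, uniformly as \<open>a\<close> tends to \<open>0\<close>.

  For a Levy process, the future after time \<open>T\<close> is a fresh copy started from the position at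
  time \<open>T\<close>. If that position is below \<open>- \<kappa>\<close>, then an excursion above \<open>0\<close> requires the fresh copy to have a
  supremum above \<open>\<kappa>\<close>, and by \<open>III\<close> this is unlikely for large \<open>\<kappa>\<close>, uniformly in \<open>a\<close>
  (\<open>levy_tail_exceeds_le\<close>). So a time \<open>T\<close> is needed at which all \<open>p a\<close> with small \<open>a\<close> are likely to be
  below \<open>- \<kappa>\<close>, and by weak convergence this can be read off from \<open>q\<close>.

  The process \<open>q\<close> does drift to minus infinity in probability. Tightness of the suprema passes to
  the limit, hence the supremum of \<open>q\<close> is finite almost surely and \<open>q\<close> cannot escape upwards. As \<open>Z\<close> is
  nondeterministic, \<open>q\<close> also cannot stay in a bounded region: its characteristic function at time \<open>n\<close> is
  an \<open>n\<close>-th power of a number of modulus less than one near the origin (\<open>nondeterministic_disperses\<close>,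
  \<open>levy_drifts_to_minus_infinity\<close>).\<close>

section \<open>Clipped suprema of paths\<close>

text \<open>The supremum over a bounded time window is not \<open>J\<^sub>1\<close>-continuous: a jump near the end of the
  window can cross it under a small time change. The remedy is a cap \<open>w\<close> as in \<open>ceiling_profile\<close> below, which
  changes with slope at most one and is under the floor \<open>l\<close> at late times. Clipping to the cap
  fades late times out continuously, and it also makes the functional bounded, so that a real-valued supremum is available without any
  compactness argument for paths.\<close>

definition trunc_sup :: "real \<Rightarrow> (real \<Rightarrow> real) \<Rightarrow> (real \<Rightarrow> real) \<Rightarrow> real" where
  "trunc_sup l w p = (SUP t\<in>{0..}. max l (min (p t) (w t)))"

definition ceiling_profile :: "real \<Rightarrow> (real \<Rightarrow> real) \<Rightarrow> bool" where
  "ceiling_profile l w \<longleftrightarrow>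
     (\<forall>s t. \<bar>w s - w t\<bar> \<le> \<bar>s - t\<bar>) \<and> bdd_above (range w) \<and> (\<exists>L. \<forall>t\<ge>L. w t \<le> l)"

text \<open>The caps in use stay at height \<open>c\<close> on a window \<open>[u, v]\<close> and fall off with slope one
  on both sides of it.\<close>

lemma ceiling_profileI:
  assumes "u \<le> v"
  shows "ceiling_profile l (\<lambda>t. c - max 0 (max (u - t) (t - v)))"
  unfolding ceiling_profile_def
proof (intro conjI)
  show "\<forall>s t. \<bar>c - max 0 (max (u - s) (s - v)) - (c - max 0 (max (u - t) (t - v)))\<bar> \<le> \<bar>s - t\<bar>"
    by (auto simp: max_def)
  show "bdd_above (range (\<lambda>t. c - max 0 (max (u - t) (t - v))))"
    by (rule bdd_aboveI[of _ c]) auto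
  show "\<exists>L. \<forall>t\<ge>L. c - max 0 (max (u - t) (t - v)) \<le> l"
    by (rule exI[of _ "v + (c - l)"]) (auto simp: max_def)
qed

lemma bdd_above_trunc:
  assumes "ceiling_profile l w"
  shows "bdd_above ((\<lambda>t. max l (min (p t) (w t))) ` A)"
proof -
  obtain c where "\<And>t. w t \<le> c"
    using assms by (auto simp: ceiling_profile_def bdd_above_def)
  then show ?thesis
    by (intro bdd_aboveI[of _ "max l c"]) (auto intro: max.mono min.coboundedI2)
qed

lemma trunc_sup_upper:
  assumes "ceiling_profile l w" "t \<ge> 0"
  shows "max l (min (p t) (w t)) \<le> trunc_sup l w p"
  unfolding trunc_sup_def using assms by (intro cSUP_upper bdd_above_trunc) auto

lemma trunc_sup_least:
  assumes "\<And>t. t \<ge> 0 \<Longrightarrow> max l (min (p t) (w t)) \<le> u"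
  shows "trunc_sup l w p \<le> u"
  unfolding trunc_sup_def using assms by (intro cSUP_least) auto

lemma trunc_sup_ge: "ceiling_profile l w \<Longrightarrow> l \<le> trunc_sup l w p"
  using trunc_sup_upper[of l w 0 p] by simp

lemma less_trunc_supD:
  assumes "y < trunc_sup l w p" "l \<le> y"
  shows "\<exists>t\<ge>0. y < p t \<and> y < w t"
proof (rule ccontr)
  assume "\<not> ?thesis"
  then have "max l (min (p t) (w t)) \<le> y" if "t \<ge> 0" for t
    using that assms(2) by (auto simp: min_le_iff_disj not_less)
  then have "trunc_sup l w p \<le> y" by (rule trunc_sup_least)
  with assms(1) show False by simp
qed

lemma trunc_sup_cong:
  "(\<And>t. t \<ge> 0 \<Longrightarrow> p t = q t) \<Longrightarrow> trunc_sup l w p = trunc_sup l w q"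
  unfolding trunc_sup_def by (intro SUP_cong) auto

lemma trunc_sup_le_add:
  assumes "ceiling_profile l w"
    and "\<And>t. t \<ge> 0 \<Longrightarrow> \<exists>s\<ge>0. max l (min (p t) (w t)) \<le> max l (min (q s) (w s)) + e"
  shows "trunc_sup l w p \<le> trunc_sup l w q + e"
proof (rule trunc_sup_least)
  fix t :: real assume "t \<ge> 0"
  then obtain s where "s \<ge> 0" "max l (min (p t) (w t)) \<le> max l (min (q s) (w s)) + e"
    using assms(2) by blast
  then show "max l (min (p t) (w t)) \<le> trunc_sup l w q + e"
    using trunc_sup_upper[OF assms(1), of s q] by linarith
qed

lemma trunc_clip_lipschitz:
  fixes l p q v w e :: real
  assumes "\<bar>p - q\<bar> \<le> e" "\<bar>v - w\<bar> \<le> e"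
  shows "\<bar>max l (min p v) - max l (min q w)\<bar> \<le> e"
  using assms by (auto simp: max_def min_def abs_le_iff)

text \<open>A time change \<open>\<tau>\<close> pairs the time \<open>t\<close> for \<open>x\<close> with the time \<open>\<tau> t\<close> for \<open>y\<close>. On a slightly
  enlarged window the clipped values at paired times differ by \<open>(1 + \<bar>b\<bar>) * \<epsilon>\<close> at most, since path,
  drift and cap all move little; beyond it both values equal the floor. As \<open>\<tau>\<close> is a bijection of the
  half-line, every time of either path has a partner, which gives both inequalities.\<close>

lemma continuous_on_trunc_sup_path:
  assumes w: "ceiling_profile l w"
  shows "continuous_on UNIV (\<lambda>x. trunc_sup l w (\<lambda>t. path x t - b * t))"
proof -
  let ?H = "\<lambda>x. trunc_sup l w (\<lambda>t. path x t - b * t)"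
  obtain L where L: "\<And>t. t \<ge> L \<Longrightarrow> w t \<le> l" using w by (auto simp: ceiling_profile_def)
  have lip: "\<bar>w s - w t\<bar> \<le> \<bar>s - t\<bar>" for s t using w by (auto simp: ceiling_profile_def)
  have "open (?H -` U)" if U: "open U" for U
    unfolding open_cadlag_def
  proof
    fix x assume "x \<in> ?H -` U"
    then obtain e where e: "e > 0" "ball (?H x) e \<subseteq> U"
      using U by (auto simp: open_contains_ball)
    \<comment> \<open>At most \<open>1\<close>, so that \<open>\<tau>\<close> cannot carry a time after \<open>L + 1\<close> to one before \<open>L\<close>.\<close>
    define \<epsilon> where "\<epsilon> = min 1 (e / (2 * (1 + \<bar>b\<bar>)))"
    have eps: "\<epsilon> > 0" "\<epsilon> \<le> 1" "(1 + \<bar>b\<bar>) * \<epsilon> < e"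
    proof -
      show "\<epsilon> > 0" "\<epsilon> \<le> 1" using e by (auto simp: \<epsilon>_def)
      have "(1 + \<bar>b\<bar>) * \<epsilon> \<le> (1 + \<bar>b\<bar>) * (e / (2 * (1 + \<bar>b\<bar>)))"
        by (intro mult_left_mono) (auto simp: \<epsilon>_def)
      also have "\<dots> = e / 2" by (auto simp: field_simps)
      finally show "(1 + \<bar>b\<bar>) * \<epsilon> < e" using e by simp
    qed
    have "\<bar>?H y - ?H x\<bar> \<le> (1 + \<bar>b\<bar>) * \<epsilon>" if "y \<in> J1_nbhd x (L + 1) \<epsilon>" for y
    proof -
      obtain \<tau> where tau: "bij_betw \<tau> {0..} {0..}" "\<And>t. t \<ge> 0 \<Longrightarrow> \<bar>\<tau> t - t\<bar> \<le> \<epsilon>"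
        "\<And>t. t \<in> {0..L+1} \<Longrightarrow> \<bar>path y (\<tau> t) - path x t\<bar> \<le> \<epsilon>"
        using \<open>y \<in> _\<close> unfolding J1_nbhd_def time_changes_def by auto
      have close: "\<bar>max l (min (path y (\<tau> t) - b * \<tau> t) (w (\<tau> t))) -
          max l (min (path x t - b * t) (w t))\<bar> \<le> (1 + \<bar>b\<bar>) * \<epsilon>" if t: "t \<ge> 0" for t
      proof (cases "t \<le> L + 1")
        case True
        have b: "\<bar>b * \<tau> t - b * t\<bar> \<le> \<bar>b\<bar> * \<epsilon>"
          using tau(2)[OF t] by (simp add: abs_mult mult_left_mono flip: right_diff_distrib)
        have "\<bar>path y (\<tau> t) - path x t\<bar> \<le> \<epsilon>" using tau(3) True t by auto
        with b have "\<bar>(path y (\<tau> t) - b * \<tau> t) - (path x t - b * t)\<bar> \<le> (1 + \<bar>b\<bar>) * \<epsilon>"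
          by (simp add: algebra_simps)
        moreover have "\<bar>w (\<tau> t) - w t\<bar> \<le> (1 + \<bar>b\<bar>) * \<epsilon>"
          using lip[of "\<tau> t" t] tau(2)[OF t] eps(1) by (smt (verit) mult_le_cancel_right1)
        ultimately show ?thesis by (rule trunc_clip_lipschitz)
      next
        case False
        then have "w t \<le> l" "w (\<tau> t) \<le> l" using L[of t] L[of "\<tau> t"] tau(2)[OF t] eps by auto
        then show ?thesis using eps(1) by (simp add: min.coboundedI2 max_absorb1)
      qed
      have "?H x \<le> ?H y + (1 + \<bar>b\<bar>) * \<epsilon>"
      proof (rule trunc_sup_le_add[OF w])
        fix t :: real assume t: "t \<ge> 0"
        then have "\<tau> t \<ge> 0" using tau(1) by (auto simp: bij_betw_def)
        then show "\<exists>s\<ge>0. max l (min (path x t - b * t) (w t))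
            \<le> max l (min (path y s - b * s) (w s)) + (1 + \<bar>b\<bar>) * \<epsilon>"
          using close[OF t] by (intro exI[of _ "\<tau> t"]) linarith
      qed
      moreover have "?H y \<le> ?H x + (1 + \<bar>b\<bar>) * \<epsilon>"
      proof (rule trunc_sup_le_add[OF w])
        fix s :: real assume s: "s \<ge> 0"
        then have "s \<in> \<tau> ` {0..}" using tau(1) by (auto simp: bij_betw_def)
        then obtain t where t: "t \<ge> 0" "s = \<tau> t" by auto
        then show "\<exists>t\<ge>0. max l (min (path y s - b * s) (w s))
            \<le> max l (min (path x t - b * t) (w t)) + (1 + \<bar>b\<bar>) * \<epsilon>"
          using close[OF t(1)] unfolding t(2) by (intro exI[of _ t]) linarith
      qed
      ultimately show ?thesis by (simp add: abs_le_iff)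
    qed
    then have "J1_nbhd x (L + 1) \<epsilon> \<subseteq> ?H -` U"
      using eps(3) e(2) by (force simp: dist_real_def abs_minus_commute)
    then show "\<exists>T. \<exists>\<epsilon>>0. J1_nbhd x T \<epsilon> \<subseteq> ?H -` U" using eps(1) by blast
  qed
  then show ?thesis by (simp add: continuous_on_open_vimage)
qed

text \<open>Only the times before \<open>L\<close> contribute, and there a change of slope moves the path
  by at most the change times \<open>L\<close>.\<close>

lemma trunc_sup_drift_lipschitz:
  assumes w: "ceiling_profile l w" and L: "\<And>t. t \<ge> L \<Longrightarrow> w t \<le> l"
  shows "\<bar>trunc_sup l w (\<lambda>t. x t - b * t) - trunc_sup l w (\<lambda>t. x t - c * t)\<bar> \<le> \<bar>b - c\<bar> * max 0 L"
proof -
  have *: "trunc_sup l w (\<lambda>t. x t - b * t) \<le> trunc_sup l w (\<lambda>t. x t - c * t) + \<bar>b - c\<bar> * max 0 L" for b c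
  proof (rule trunc_sup_le_add[OF w], intro exI conjI)
    fix t :: real assume t: "t \<ge> 0"
    show "max l (min (x t - b * t) (w t)) \<le> max l (min (x t - c * t) (w t)) + \<bar>b - c\<bar> * max 0 L"
    proof (cases "t \<le> L")
      case True
      have "\<bar>(x t - b * t) - (x t - c * t)\<bar> = \<bar>b - c\<bar> * t"
        using t by (simp add: abs_mult abs_minus_commute flip: left_diff_distrib)
      also have "\<dots> \<le> \<bar>b - c\<bar> * max 0 L" using True by (intro mult_left_mono) auto
      finally have "\<bar>max l (min (x t - b * t) (w t)) - max l (min (x t - c * t) (w t))\<bar> \<le> \<bar>b - c\<bar> * max 0 L"
        by (rule trunc_clip_lipschitz) simp
      then show ?thesis by (simp only: abs_diff_le_iff)
    next
      case False
      then show ?thesis using L[of t] by (simp add: min.coboundedI2 max_absorb1)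
    qed
  qed
  show ?thesis using *[of b c] *[of c b] unfolding abs_diff_le_iff abs_minus_commute[of c b] by linarith
qed

text \<open>If the path never exceeds \<open>\<kappa>\<close> and is nonpositive from \<open>T\<close> on, then clipping to the window
  \<open>[0, T]\<close> at height \<open>\<kappa>\<close> loses nothing: the supremum is at least \<open>p 0 = 0\<close>, the floor. The cap has the form of
  \<open>ceiling_profileI\<close> with \<open>u = 0\<close>.\<close>

lemma trunc_sup_eq_SUP:
  assumes "p 0 = 0" and T: "0 \<le> T" and le: "\<And>t. t \<ge> 0 \<Longrightarrow> p t \<le> \<kappa>" and neg: "\<And>t. t \<ge> T \<Longrightarrow> p t \<le> 0"
  shows "ereal (trunc_sup 0 (\<lambda>t. \<kappa> - max 0 (max (0 - t) (t - T))) p) = (SUP t\<in>{0..}. ereal (p t))"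
    (is "ereal (trunc_sup 0 ?w p) = ?S")
proof (rule antisym)
  have w: "ceiling_profile 0 ?w" by (rule ceiling_profileI[OF T])
  have S: "ereal (p t) \<le> ?S" if "t \<ge> 0" for t using that by (intro SUP_upper) auto
  have "0 \<le> ?S" using S[of 0] \<open>p 0 = 0\<close> by (simp add: zero_ereal_def)
  moreover have "?S \<le> ereal \<kappa>" using le by (intro SUP_least) auto
  ultimately obtain s where s: "?S = ereal s" "0 \<le> s" by (cases ?S) auto
  have "trunc_sup 0 ?w p \<le> s"
    using S s by (intro trunc_sup_least) (auto simp: min.coboundedI1)
  then show "ereal (trunc_sup 0 ?w p) \<le> ?S" using s by simp
  show "?S \<le> ereal (trunc_sup 0 ?w p)"
  proof (rule SUP_least)
    fix t :: real assume "t \<in> {0..}"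
    then have t: "t \<ge> 0" by simp
    have "p t \<le> max 0 (min (p t) (?w t))"
    proof (cases "t \<le> T")
      case True
      then have "?w t = \<kappa>" using t by simp
      then show ?thesis using le[OF t] by simp
    next
      case False
      then show ?thesis using neg[of t] by simp
    qed
    also have "\<dots> \<le> trunc_sup 0 ?w p" by (rule trunc_sup_upper[OF w t])
    finally show "ereal (p t) \<le> ereal (trunc_sup 0 ?w p)" by simp
  qed
qed

section \<open>Convergence in distribution of clipped suprema\<close>

lemma conv_in_dist_cong:
  fixes Z :: "'b \<Rightarrow> 'c::topological_space"
  assumes "conv_in_dist M Y N Z G"
    and "\<forall>\<^sub>F i in G. \<forall>\<omega>\<in>space (M i). Y i \<omega> = Y' i \<omega>"
    and "\<And>\<omega>. \<omega> \<in> space N \<Longrightarrow> Z \<omega> = Z' \<omega>"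
  shows "conv_in_dist M Y' N Z' G"
  unfolding conv_in_dist_def
proof (intro conjI allI impI)
  have "\<forall>\<^sub>F i in G. Y i \<in> borel_measurable (M i)" using assms(1) by (auto simp: conv_in_dist_def)
  then show "\<forall>\<^sub>F i in G. Y' i \<in> borel_measurable (M i)"
    using assms(2) by eventually_elim (simp cong: measurable_cong)
  show "Z' \<in> borel_measurable N"
    using assms(1) measurable_cong[of N Z Z' borel, OF assms(3)] by (simp add: conv_in_dist_def)
  fix f :: "'c \<Rightarrow> real" assume "continuous_on UNIV f \<and> bounded (range f)"
  then have *: "((\<lambda>i. \<integral>\<omega>. f (Y i \<omega>) \<partial>M i) \<longlongrightarrow> (\<integral>\<omega>. f (Z \<omega>) \<partial>N)) G"
    using assms(1) by (auto simp: conv_in_dist_def)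
  have "\<forall>\<^sub>F i in G. (\<integral>\<omega>. f (Y i \<omega>) \<partial>M i) = (\<integral>\<omega>. f (Y' i \<omega>) \<partial>M i)"
    using assms(2) by eventually_elim (rule Bochner_Integration.integral_cong, simp_all)
  moreover have "(\<integral>\<omega>. f (Z \<omega>) \<partial>N) = (\<integral>\<omega>. f (Z' \<omega>) \<partial>N)"
    using assms(3) by (intro Bochner_Integration.integral_cong) simp_all
  ultimately show "((\<lambda>i. \<integral>\<omega>. f (Y' i \<omega>) \<partial>M i) \<longlongrightarrow> (\<integral>\<omega>. f (Z' \<omega>) \<partial>N)) G"
    using Lim_transform_eventually[OF *] by simp
qed

text \<open>The functional varies with \<open>i\<close> through its slope, so the continuous mapping argument
  applies to the limiting slope only. The error is controlled because all values lie in one compact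
  interval, on which the test function is uniformly continuous.\<close>

lemma conv_in_dist_trunc_sup:
  assumes w: "ceiling_profile l w"
    and prob: "\<forall>\<^sub>F i in G. prob_space (M i)"
    and conv: "conv_in_dist M Y N Z G"
    and b: "(b \<longlongrightarrow> \<beta>) G"
  shows "conv_in_dist M (\<lambda>i \<omega>. trunc_sup l w (\<lambda>t. path (Y i \<omega>) t - b i * t))
           N (\<lambda>\<omega>. trunc_sup l w (\<lambda>t. path (Z \<omega>) t - \<beta> * t)) G"
proof -
  define H where "H b x = trunc_sup l w (\<lambda>t. path x t - b * t)" for b x
  have H: "continuous_on UNIV (H c)" for c
    unfolding H_def by (rule continuous_on_trunc_sup_path[OF w])
  have Hm: "H c \<in> borel_measurable borel" for c
    by (rule borel_measurable_continuous_onI[OF H])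
  obtain L where L: "\<And>t. t \<ge> L \<Longrightarrow> w t \<le> l" using w by (auto simp: ceiling_profile_def)
  obtain C where C: "\<And>t. w t \<le> C" "l \<le> C"
  proof -
    obtain c where "\<And>t. w t \<le> c" using w by (auto simp: ceiling_profile_def bdd_above_def)
    then show thesis by (intro that[of "max l c"]) (auto intro: max.coboundedI2)
  qed
  have range: "H c x \<in> {l..C}" for c x
    using trunc_sup_ge[OF w] trunc_sup_least[of l "\<lambda>t. path x t - c * t" w C] C
    by (auto simp: H_def min.coboundedI2)
  have Ym: "\<forall>\<^sub>F i in G. Y i \<in> borel_measurable (M i)" and Zm: "Z \<in> borel_measurable N"
    using conv by (auto simp: conv_in_dist_def)
  have "conv_in_dist M (\<lambda>i \<omega>. H (b i) (Y i \<omega>)) N (\<lambda>\<omega>. H \<beta> (Z \<omega>)) G"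
    unfolding conv_in_dist_def
  proof (intro conjI allI impI)
    show "\<forall>\<^sub>F i in G. (\<lambda>\<omega>. H (b i) (Y i \<omega>)) \<in> borel_measurable (M i)"
      using Ym by eventually_elim (rule measurable_compose[OF _ Hm])
    show "(\<lambda>\<omega>. H \<beta> (Z \<omega>)) \<in> borel_measurable N"
      by (rule measurable_compose[OF Zm Hm])
    fix g :: "real \<Rightarrow> real" assume g: "continuous_on UNIV g \<and> bounded (range g)"
    obtain B where B: "\<And>x. \<bar>g x\<bar> \<le> B" using g by (auto simp: bounded_iff)
    have gm: "g \<in> borel_measurable borel" using g by (intro borel_measurable_continuous_onI) auto
    have "continuous_on UNIV (g \<circ> H \<beta>)"
      by (rule continuous_on_compose[OF H]) (use g continuous_on_subset in auto)
    moreover have "bounded (range (g \<circ> H \<beta>))"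
      using B by (auto simp: bounded_iff)
    ultimately have lim: "((\<lambda>i. \<integral>\<omega>. g (H \<beta> (Y i \<omega>)) \<partial>M i) \<longlongrightarrow> (\<integral>\<omega>. g (H \<beta> (Z \<omega>)) \<partial>N)) G"
      using conv unfolding conv_in_dist_def by (auto dest!: spec[of _ "g \<circ> H \<beta>"])
    have "((\<lambda>i. (\<integral>\<omega>. g (H (b i) (Y i \<omega>)) \<partial>M i) - (\<integral>\<omega>. g (H \<beta> (Y i \<omega>)) \<partial>M i)) \<longlongrightarrow> 0) G"
    proof (rule tendstoI)
      fix e :: real assume e: "e > 0"
      have "uniformly_continuous_on {l..C} g"
        using g by (intro compact_uniformly_continuous) (auto intro: continuous_on_subset)
      then obtain \<delta> where \<delta>: "\<delta> > 0"
        "\<And>x y. x \<in> {l..C} \<Longrightarrow> y \<in> {l..C} \<Longrightarrow> \<bar>x - y\<bar> < \<delta> \<Longrightarrow> \<bar>g x - g y\<bar> < e / 2"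
        using e unfolding uniformly_continuous_on_def dist_real_def
        by (metis half_gt_zero abs_minus_commute)
      have "((\<lambda>i. \<bar>b i - \<beta>\<bar> * max 0 L) \<longlongrightarrow> 0) G"
        using b by (auto intro!: tendsto_eq_intros)
      then have "\<forall>\<^sub>F i in G. \<bar>b i - \<beta>\<bar> * max 0 L < \<delta>"
        using \<delta>(1) by (auto dest: order_tendstoD)
      then show "\<forall>\<^sub>F i in G. dist ((\<integral>\<omega>. g (H (b i) (Y i \<omega>)) \<partial>M i) - (\<integral>\<omega>. g (H \<beta> (Y i \<omega>)) \<partial>M i)) 0 < e"
        using Ym prob
      proof eventually_elim
        case (elim i)
        interpret prob_space "M i" by fact
        have close: "\<bar>g (H (b i) x) - g (H \<beta> x)\<bar> \<le> e / 2" for x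
        proof -
          have "\<bar>H (b i) x - H \<beta> x\<bar> < \<delta>"
            unfolding H_def by (rule order.strict_trans1[OF trunc_sup_drift_lipschitz[OF w L] elim(1)])
          from \<delta>(2)[OF range range this] show ?thesis by (rule less_imp_le)
        qed
        have int: "integrable (M i) (\<lambda>\<omega>. g (H c (Y i \<omega>)))" for c
          using B measurable_compose[OF measurable_compose[OF elim(2) Hm] gm]
          by (intro integrable_const_bound[of _ B]) auto
        have "\<bar>(\<integral>\<omega>. g (H (b i) (Y i \<omega>)) \<partial>M i) - (\<integral>\<omega>. g (H \<beta> (Y i \<omega>)) \<partial>M i)\<bar>
            = \<bar>\<integral>\<omega>. g (H (b i) (Y i \<omega>)) - g (H \<beta> (Y i \<omega>)) \<partial>M i\<bar>"
          using int by simp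
        also have "\<dots> \<le> (\<integral>\<omega>. \<bar>g (H (b i) (Y i \<omega>)) - g (H \<beta> (Y i \<omega>))\<bar> \<partial>M i)"
          by (rule integral_abs_bound)
        also have "\<dots> \<le> e / 2"
          using int close by (intro integral_le_const integrable_abs) auto
        finally show ?case using e by simp
      qed
    qed
    from Lim_transform[OF lim this]
    show "((\<lambda>i. \<integral>\<omega>. g (H (b i) (Y i \<omega>)) \<partial>M i) \<longlongrightarrow> (\<integral>\<omega>. g (H \<beta> (Z \<omega>)) \<partial>N)) G" .
  qed
  then show ?thesis by (simp add: H_def)
qed

text \<open>Half of the portmanteau theorem, in the form of two one-sided comparisons of tails:
  a piecewise linear function separates the two thresholds.\<close>

lemma conv_in_dist_eventually_prob_le:
  fixes U :: "'i \<Rightarrow> 'a \<Rightarrow> real" and V :: "'b \<Rightarrow> real"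
  assumes conv: "conv_in_dist M U N V G"
    and prob: "\<forall>\<^sub>F i in G. prob_space (M i)" "prob_space N"
    and "x < y" "\<delta> > 0"
  shows "\<forall>\<^sub>F i in G. measure (M i) {\<omega>\<in>space (M i). y \<le> U i \<omega>} \<le> measure N {\<omega>\<in>space N. x < V \<omega>} + \<delta>"
    and "\<forall>\<^sub>F i in G. measure N {\<omega>\<in>space N. y \<le> V \<omega>} \<le> measure (M i) {\<omega>\<in>space (M i). x < U i \<omega>} + \<delta>"
proof -
  define f where "f v = max 0 (min 1 ((v - x) / (y - x)))" for v :: real
  have f: "continuous_on UNIV f" "bounded (range f)"
    unfolding f_def using \<open>x < y\<close> by (auto intro!: continuous_intros boundedI[of _ 1])
  have fm: "f \<in> borel_measurable borel" by (rule borel_measurable_continuous_onI[OF f(1)])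
  have f_le: "f v \<le> indicator {x<..} v" and f_ge: "indicator {y..} v \<le> f v" for v
    using \<open>x < y\<close> by (auto simp: f_def indicator_def divide_nonpos_pos min_def max_def field_simps)
  have sandwich: "measure P {\<omega>\<in>space P. y \<le> W \<omega>} \<le> (\<integral>\<omega>. f (W \<omega>) \<partial>P)"
    "(\<integral>\<omega>. f (W \<omega>) \<partial>P) \<le> measure P {\<omega>\<in>space P. x < W \<omega>}"
    if "prob_space P" and [measurable]: "W \<in> borel_measurable P" for P :: "'c measure" and W
  proof -
    interpret prob_space P by fact
    note fm[measurable]
    have int: "integrable P (\<lambda>\<omega>. f (W \<omega>))"
      by (intro integrable_const_bound[of _ 1]) (auto simp: f_def)
    have ev: "{\<omega>\<in>space P. y \<le> W \<omega>} \<in> sets P" "{\<omega>\<in>space P. x < W \<omega>} \<in> sets P" by measurable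
    have "measure P {\<omega>\<in>space P. y \<le> W \<omega>} = (\<integral>\<omega>. indicator {\<omega>\<in>space P. y \<le> W \<omega>} \<omega> \<partial>P)"
      unfolding Bochner_Integration.integral_indicator by (rule arg_cong[where f = "measure P"]) blast
    also have "\<dots> \<le> (\<integral>\<omega>. f (W \<omega>) \<partial>P)"
    proof (rule integral_mono[OF _ int])
      show "integrable P (indicat_real {\<omega> \<in> space P. y \<le> W \<omega>})"
        using ev by (intro integrable_real_indicator) (auto simp: less_top[symmetric])
      show "indicat_real {\<omega> \<in> space P. y \<le> W \<omega>} \<omega> \<le> f (W \<omega>)" if "\<omega> \<in> space P" for \<omega>
        using f_ge[of "W \<omega>"] that by (auto simp: indicator_def)
    qed
    finally show "measure P {\<omega>\<in>space P. y \<le> W \<omega>} \<le> (\<integral>\<omega>. f (W \<omega>) \<partial>P)" .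
    have "(\<integral>\<omega>. f (W \<omega>) \<partial>P) \<le> (\<integral>\<omega>. indicator {\<omega>\<in>space P. x < W \<omega>} \<omega> \<partial>P)"
    proof (rule integral_mono[OF int])
      show "integrable P (indicat_real {\<omega> \<in> space P. x < W \<omega>})"
        using ev by (intro integrable_real_indicator) (auto simp: less_top[symmetric])
      show "f (W \<omega>) \<le> indicat_real {\<omega> \<in> space P. x < W \<omega>} \<omega>" if "\<omega> \<in> space P" for \<omega>
        using f_le[of "W \<omega>"] that by (auto simp: indicator_def)
    qed
    also have "\<dots> = measure P {\<omega>\<in>space P. x < W \<omega>}"
      unfolding Bochner_Integration.integral_indicator by (rule arg_cong[where f = "measure P"]) blast
    finally show "(\<integral>\<omega>. f (W \<omega>) \<partial>P) \<le> measure P {\<omega>\<in>space P. x < W \<omega>}" .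
  qed
  have Um: "\<forall>\<^sub>F i in G. U i \<in> borel_measurable (M i)" and Vm: "V \<in> borel_measurable N"
    and lim: "((\<lambda>i. \<integral>\<omega>. f (U i \<omega>) \<partial>M i) \<longlongrightarrow> (\<integral>\<omega>. f (V \<omega>) \<partial>N)) G"
    using conv f by (auto simp: conv_in_dist_def)
  have "\<forall>\<^sub>F i in G. dist (\<integral>\<omega>. f (U i \<omega>) \<partial>M i) (\<integral>\<omega>. f (V \<omega>) \<partial>N) < \<delta>"
    using lim \<open>\<delta> > 0\<close> by (rule tendstoD)
  then have both: "\<forall>\<^sub>F i in G.
      measure (M i) {\<omega>\<in>space (M i). y \<le> U i \<omega>} \<le> measure N {\<omega>\<in>space N. x < V \<omega>} + \<delta> \<and>
      measure N {\<omega>\<in>space N. y \<le> V \<omega>} \<le> measure (M i) {\<omega>\<in>space (M i). x < U i \<omega>} + \<delta>"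
    using Um prob(1)
  proof eventually_elim
    case (elim i)
    then show ?case
      using sandwich(1)[OF elim(3,2)] sandwich(2)[OF elim(3,2)]
        sandwich(1)[OF prob(2) Vm] sandwich(2)[OF prob(2) Vm]
      by (auto simp: dist_real_def)
  qed
  from both show "\<forall>\<^sub>F i in G. measure (M i) {\<omega>\<in>space (M i). y \<le> U i \<omega>} \<le> measure N {\<omega>\<in>space N. x < V \<omega>} + \<delta>"
    by (rule eventually_mono) simp
  from both show "\<forall>\<^sub>F i in G. measure N {\<omega>\<in>space N. y \<le> V \<omega>} \<le> measure (M i) {\<omega>\<in>space (M i). x < U i \<omega>} + \<delta>"
    by (rule eventually_mono) simp
qed

section \<open>Suprema of right-continuous processes\<close>

text \<open>The grid has mesh \<open>1 / 2^m\<close> and reaches up to \<open>2^m\<close>, so both its fineness and its range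
  grow with \<open>m\<close>; the grids are nested.\<close>

definition dyadic_grid :: "nat \<Rightarrow> real set" where
  "dyadic_grid m = (\<lambda>i. real i / 2 ^ m) ` {..4 ^ m}"

lemma dyadic_grid_nonneg: "q \<in> dyadic_grid m \<Longrightarrow> q \<ge> 0"
  by (auto simp: dyadic_grid_def)

lemma dyadic_grid_le:
  assumes "q \<in> dyadic_grid m"
  shows "q \<le> 2 ^ m"
proof -
  obtain i :: nat where i: "i \<le> 4 ^ m" "q = real i / 2 ^ m" using assms by (auto simp: dyadic_grid_def)
  have "real i \<le> real (4 ^ m)" using i(1) unfolding of_nat_le_iff .
  also have "\<dots> = 2 ^ m * 2 ^ m" unfolding power_mult_distrib[symmetric] by simp
  finally show ?thesis using i(2) by (simp add: pos_divide_le_eq)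
qed

lemma finite_dyadic_grid: "finite (dyadic_grid m)"
  by (simp add: dyadic_grid_def)

lemma dyadic_grid_Suc: "dyadic_grid m \<subseteq> dyadic_grid (Suc m)"
proof
  fix q assume "q \<in> dyadic_grid m"
  then obtain i where i: "i \<le> 4 ^ m" "q = real i / 2 ^ m" by (auto simp: dyadic_grid_def)
  then have "q = real (2 * i) / 2 ^ Suc m" "2 * i \<le> 4 ^ Suc m" by auto
  then show "q \<in> dyadic_grid (Suc m)" unfolding dyadic_grid_def by blast
qed

text \<open>Rounding \<open>t\<close> up strictly to mesh \<open>1 / 2^(m + 1)\<close>: approach from strictly above is what
  right-continuity of a path can use.\<close>

lemma right_limit_dyadic:
  fixes t :: real
  assumes "t \<ge> 0"
  obtains q where "filterlim q (at_right t) sequentially" "\<And>m. t \<le> real m \<Longrightarrow> q m \<in> dyadic_grid (Suc m)"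
proof -
  define c :: "nat \<Rightarrow> real" where "c m = 2 ^ Suc m" for m
  define k where "k m = Suc (nat \<lfloor>t * c m\<rfloor>)" for m
  define q where "q m = real (k m) / c m" for m
  have c: "c m > 0" for m by (simp add: c_def)
  have k: "t * c m < real (k m)" "real (k m) \<le> t * c m + 1" for m
  proof -
    have "0 \<le> t * c m" using assms c[of m] by simp
    then have *: "real (k m) = of_int \<lfloor>t * c m\<rfloor> + 1" by (simp add: k_def)
    show "t * c m < real (k m)" "real (k m) \<le> t * c m + 1"
      using floor_correct[of "t * c m"] unfolding * by auto
  qed
  have gt: "t < q m" for m
    unfolding q_def using k(1) c by (simp add: pos_less_divide_eq)
  have le: "q m \<le> t + (1/2) ^ Suc m" for m
  proof -
    have "q m \<le> (t * c m + 1) / c m"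
      unfolding q_def using c by (intro divide_right_mono k less_imp_le)
    also have "\<dots> = t + 1 / c m" using c[of m] by (simp add: add_divide_distrib)
    also have "\<dots> = t + (1/2) ^ Suc m" by (simp add: c_def power_one_over)
    finally show ?thesis .
  qed
  have "(\<lambda>m. t + (1/2) ^ Suc m) \<longlonglongrightarrow> t + 0"
    by (intro tendsto_intros LIMSEQ_Suc LIMSEQ_power_zero) auto
  then have "q \<longlonglongrightarrow> t"
    using gt le by (intro tendsto_sandwich[OF _ _ tendsto_const[of t], of q _ "\<lambda>m. t + (1/2) ^ Suc m"])
      (simp_all add: less_imp_le)
  then have "filterlim q (at_right t) sequentially"
    using gt less_imp_neq[OF gt, THEN not_sym] by (simp add: filterlim_at)
  moreover have "q m \<in> dyadic_grid (Suc m)" if m: "t \<le> real m" for m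
  proof -
    have "real (Suc m) \<le> real (2 ^ Suc m)"
      unfolding of_nat_le_iff by (rule less_imp_le[OF less_exp])
    then have m1: "real m + 1 \<le> c m" by (simp add: c_def)
    have "real (k m) \<le> t * c m + 1" by (rule k)
    also have "\<dots> \<le> real m * c m + c m"
    proof (rule add_mono)
      show "t * c m \<le> real m * c m" using m c[of m] by simp
      show "1 \<le> c m" using m1 by linarith
    qed
    also have "\<dots> = (real m + 1) * c m" by (simp add: distrib_right)
    also have "\<dots> \<le> c m * c m" using m1 c[of m] by (intro mult_right_mono) auto
    also have "c m * c m = real (4 ^ Suc m)"
      unfolding c_def power_mult_distrib[symmetric] by simp
    finally have "k m \<le> 4 ^ Suc m" unfolding of_nat_le_iff .
    then show ?thesis unfolding dyadic_grid_def q_def c_def by (intro image_eqI[of _ _ "k m"]) simp_all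
  qed
  ultimately show thesis by (rule that)
qed

definition right_cont :: "(real \<Rightarrow> real) \<Rightarrow> bool" where
  "right_cont x \<longleftrightarrow> (\<forall>t\<ge>0. (x \<longlongrightarrow> x t) (at_right t))"

lemma is_cadlag_right_cont: "is_cadlag x \<Longrightarrow> right_cont x"
  by (simp add: is_cadlag_def right_cont_def)

lemma right_cont_shift:
  assumes "right_cont x" "s \<ge> 0"
  shows "right_cont (\<lambda>t. x (s + t) - c)"
  unfolding right_cont_def
proof (intro allI impI)
  fix t :: real assume "t \<ge> 0"
  have "filterlim (\<lambda>u. s + u) (at_right (s + t)) (at_right t)"
    by (auto simp: filterlim_at eventually_at_filter intro!: tendsto_eq_intros)
  moreover have "(x \<longlongrightarrow> x (s + t)) (at_right (s + t))"
    using assms \<open>t \<ge> 0\<close> by (simp add: right_cont_def)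
  ultimately have "((\<lambda>u. x (s + u)) \<longlongrightarrow> x (s + t)) (at_right t)" by (rule filterlim_compose[rotated])
  then show "((\<lambda>t. x (s + t) - c) \<longlongrightarrow> x (s + t) - c) (at_right t)"
    by (intro tendsto_intros)
qed

text \<open>This reduces suprema over a continuum of times to finite maxima, both for measurability
  and, through \<open>prob_exceeds_le\<close>, for probabilities.\<close>

lemma right_cont_exceeds_on_grid:
  assumes "right_cont x"
  shows "(\<exists>t\<ge>0. k < x t) \<longleftrightarrow> (\<exists>m. \<exists>q\<in>dyadic_grid m. k < x q)"
proof
  assume "\<exists>t\<ge>0. k < x t"
  then obtain t where t: "t \<ge> 0" "k < x t" by blast
  obtain q where q: "filterlim q (at_right t) sequentially"
    "\<And>m. t \<le> real m \<Longrightarrow> q m \<in> dyadic_grid (Suc m)"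
    using right_limit_dyadic[OF t(1)] by metis
  have "(x \<longlongrightarrow> x t) (at_right t)" using assms t(1) by (simp add: right_cont_def)
  then have "(\<lambda>m. x (q m)) \<longlonglongrightarrow> x t" by (rule filterlim_compose[OF _ q(1)])
  then have "\<forall>\<^sub>F m in sequentially. k < x (q m)" using t(2) by (rule order_tendstoD)
  moreover have "\<forall>\<^sub>F m in sequentially. t \<le> real m"
    using filterlim_real_sequentially by (auto simp: filterlim_at_top)
  ultimately have "\<forall>\<^sub>F m in sequentially. k < x (q m) \<and> t \<le> real m" by eventually_elim simp
  then obtain m where "k < x (q m)" "t \<le> real m" by (auto dest: eventually_happens)
  then show "\<exists>m. \<exists>q\<in>dyadic_grid m. k < x q" using q(2) by blast
qed (use dyadic_grid_nonneg in blast)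

lemma sets_exceeds:
  assumes meas: "\<And>t. t \<ge> 0 \<Longrightarrow> X t \<in> borel_measurable M"
    and rc: "\<And>\<omega>. \<omega> \<in> space M \<Longrightarrow> right_cont (\<lambda>t. X t \<omega>)"
  shows "{\<omega>\<in>space M. \<exists>t\<ge>0. k < X t \<omega>} \<in> sets M"
proof -
  have eq: "{\<omega>\<in>space M. \<exists>t\<ge>0. k < X t \<omega>} = (\<Union>m. \<Union>q\<in>dyadic_grid m. {\<omega>\<in>space M. k < X q \<omega>})"
    using right_cont_exceeds_on_grid[OF rc] by (intro set_eqI) (simp, blast?)
  have "{\<omega>\<in>space M. k < X q \<omega>} \<in> sets M" if "q \<in> dyadic_grid m" for q m
    using meas[OF dyadic_grid_nonneg[OF that]] by measurable
  then show ?thesis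
    unfolding eq by (intro sets.countable_nat_UN image_subsetI sets.finite_UN finite_dyadic_grid)
qed

lemma sets_exceeds_after:
  assumes meas: "\<And>t. t \<ge> 0 \<Longrightarrow> X t \<in> borel_measurable M"
    and rc: "\<And>\<omega>. \<omega> \<in> space M \<Longrightarrow> right_cont (\<lambda>t. X t \<omega>)"
    and s: "0 \<le> s"
  shows "{\<omega>\<in>space M. \<exists>t\<ge>s. k < X t \<omega>} \<in> sets M"
proof -
  have "{\<omega>\<in>space M. \<exists>t\<ge>0. k < X (s + t) \<omega> - 0} \<in> sets M"
    using s by (intro sets_exceeds right_cont_shift rc borel_measurable_diff meas) auto
  moreover have "(\<exists>t\<ge>0. k < X (s + t) \<omega> - 0) \<longleftrightarrow> (\<exists>t\<ge>s. k < X t \<omega>)" for \<omega>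
  proof
    assume "\<exists>t\<ge>0. k < X (s + t) \<omega> - 0"
    then obtain t where "t \<ge> 0" "k < X (s + t) \<omega>" by auto
    then show "\<exists>t\<ge>s. k < X t \<omega>" by (intro exI[of _ "s + t"]) auto
  next
    assume "\<exists>t\<ge>s. k < X t \<omega>"
    then obtain t where "t \<ge> s" "k < X t \<omega>" by blast
    then show "\<exists>t\<ge>0. k < X (s + t) \<omega> - 0" by (intro exI[of _ "t - s"]) auto
  qed
  ultimately show ?thesis by simp
qed

lemma borel_measurable_SUP_right_cont:
  assumes meas: "\<And>t. t \<ge> 0 \<Longrightarrow> X t \<in> borel_measurable M"
    and rc: "\<And>\<omega>. \<omega> \<in> space M \<Longrightarrow> right_cont (\<lambda>t. X t \<omega>)"
  shows "(\<lambda>\<omega>. SUP t\<in>{0..}. ereal (X t \<omega>)) \<in> borel_measurable M"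
proof (rule borel_measurableI_greater)
  fix y :: ereal
  have eq: "{\<omega>\<in>space M. y < (SUP t\<in>{0..}. ereal (X t \<omega>))} = {\<omega>\<in>space M. \<exists>t\<ge>0. y < ereal (X t \<omega>)}"
    by (auto simp: less_SUP_iff)
  show "{\<omega>\<in>space M. y < (SUP t\<in>{0..}. ereal (X t \<omega>))} \<in> sets M"
    unfolding eq using sets_exceeds[OF assms] by (cases y) auto
qed

lemma (in prob_space) prob_exceeds_le:
  assumes meas: "\<And>t. t \<ge> 0 \<Longrightarrow> X t \<in> borel_measurable M"
    and rc: "\<And>\<omega>. \<omega> \<in> space M \<Longrightarrow> right_cont (\<lambda>t. X t \<omega>)"
    and le: "\<And>m. prob {\<omega>\<in>space M. \<exists>q\<in>dyadic_grid m. k < X q \<omega>} \<le> p"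
  shows "prob {\<omega>\<in>space M. \<exists>t\<ge>0. k < X t \<omega>} \<le> p"
proof -
  let ?A = "\<lambda>m. {\<omega>\<in>space M. \<exists>q\<in>dyadic_grid m. k < X q \<omega>}"
  have "?A m \<in> events" for m
  proof -
    have "?A m = (\<Union>q\<in>dyadic_grid m. {\<omega>\<in>space M. k < X q \<omega>})" by auto
    moreover have "{\<omega>\<in>space M. k < X q \<omega>} \<in> events" if "q \<in> dyadic_grid m" for q
      using meas[OF dyadic_grid_nonneg[OF that]] by measurable
    ultimately show ?thesis by (auto intro!: sets.finite_UN finite_dyadic_grid)
  qed
  moreover have "incseq ?A" using dyadic_grid_Suc by (auto intro!: incseq_SucI)
  ultimately have "(\<lambda>m. prob (?A m)) \<longlonglongrightarrow> prob (\<Union>m. ?A m)"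
    by (intro finite_Lim_measure_incseq) auto
  then have "prob (\<Union>m. ?A m) \<le> p" by (rule LIMSEQ_le_const2) (use le in auto)
  also have "(\<Union>m. ?A m) = {\<omega>\<in>space M. \<exists>t\<ge>0. k < X t \<omega>}"
    using right_cont_exceeds_on_grid[OF rc] by (intro set_eqI) (simp, blast?)
  finally show ?thesis .
qed

lemma (in prob_space) abs_expectation_diff_le:
  fixes g h :: "'a \<Rightarrow> real"
  assumes [measurable]: "g \<in> borel_measurable M" "h \<in> borel_measurable M"
    and bound: "\<And>\<omega>. \<bar>g \<omega>\<bar> \<le> B" "\<And>\<omega>. \<bar>h \<omega>\<bar> \<le> B"
    and A: "A \<in> events" and eq: "\<And>\<omega>. \<omega> \<in> space M - A \<Longrightarrow> g \<omega> = h \<omega>"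
  shows "\<bar>expectation g - expectation h\<bar> \<le> 2 * B * prob A"
proof -
  have int: "integrable M g" "integrable M h"
    using bound by (auto intro!: integrable_const_bound[of _ B])
  have "\<bar>expectation g - expectation h\<bar> = \<bar>\<integral>\<omega>. g \<omega> - h \<omega> \<partial>M\<bar>" using int by simp
  also have "\<dots> \<le> (\<integral>\<omega>. \<bar>g \<omega> - h \<omega>\<bar> \<partial>M)" by (rule integral_abs_bound)
  also have "\<dots> \<le> (\<integral>\<omega>. 2 * B * indicator A \<omega> \<partial>M)"
  proof (rule integral_mono)
    show "integrable M (\<lambda>\<omega>. \<bar>g \<omega> - h \<omega>\<bar>)" using int by auto
    show "integrable M (\<lambda>\<omega>. 2 * B * indicat_real A \<omega>)"
      using A by (intro integrable_mult_right integrable_real_indicator) (auto simp: less_top[symmetric])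
    fix \<omega> assume "\<omega> \<in> space M"
    then show "\<bar>g \<omega> - h \<omega>\<bar> \<le> 2 * B * indicat_real A \<omega>"
      using eq[of \<omega>] bound[of \<omega>] by (cases "\<omega> \<in> A") auto
  qed
  also have "\<dots> = 2 * B * prob A" using A by simp
  finally show ?thesis .
qed

text \<open>The all-time supremum and its clipped version agree outside of two events: the path
  exceeds the cap, or it is positive after the window.\<close>

lemma (in prob_space) expectation_SUP_approx:
  fixes f :: "ereal \<Rightarrow> real"
  assumes meas: "\<And>t. t \<ge> 0 \<Longrightarrow> p t \<in> borel_measurable M"
    and rc: "\<And>\<omega>. \<omega> \<in> space M \<Longrightarrow> right_cont (\<lambda>t. p t \<omega>)"
    and p0: "\<And>\<omega>. \<omega> \<in> space M \<Longrightarrow> p 0 \<omega> = 0"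
    and f: "continuous_on UNIV f" "\<And>x. \<bar>f x\<bar> \<le> B"
    and T: "0 \<le> T"
    and U: "(\<lambda>\<omega>. trunc_sup 0 (\<lambda>t. \<kappa> - max 0 (max (0 - t) (t - T))) (\<lambda>t. p t \<omega>)) \<in> borel_measurable M"
      (is "?U \<in> _")
  shows "\<bar>(\<integral>\<omega>. f (SUP t\<in>{0..}. ereal (p t \<omega>)) \<partial>M) - (\<integral>\<omega>. f (ereal (?U \<omega>)) \<partial>M)\<bar> \<le>
    2 * B * (prob {\<omega>\<in>space M. \<exists>t\<ge>0. \<kappa> < p t \<omega>} + prob {\<omega>\<in>space M. \<exists>t\<ge>T. 0 < p t \<omega>})"
proof -
  let ?A = "{\<omega>\<in>space M. \<exists>t\<ge>0. \<kappa> < p t \<omega>}" and ?C = "{\<omega>\<in>space M. \<exists>t\<ge>T. 0 < p t \<omega>}"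
  have fm: "f \<in> borel_measurable borel" by (rule borel_measurable_continuous_onI[OF f(1)])
  have A: "?A \<in> events" by (rule sets_exceeds[OF meas rc])
  have C: "?C \<in> events" by (rule sets_exceeds_after[OF meas rc T])
  have "\<bar>(\<integral>\<omega>. f (SUP t\<in>{0..}. ereal (p t \<omega>)) \<partial>M) - (\<integral>\<omega>. f (ereal (?U \<omega>)) \<partial>M)\<bar> \<le> 2 * B * prob (?A \<union> ?C)"
  proof (rule abs_expectation_diff_le)
    show "(\<lambda>\<omega>. f (SUP t\<in>{0..}. ereal (p t \<omega>))) \<in> borel_measurable M"
      by (rule measurable_compose[OF borel_measurable_SUP_right_cont[OF meas rc] fm])
    show "(\<lambda>\<omega>. f (ereal (?U \<omega>))) \<in> borel_measurable M"
      by (rule measurable_compose[OF borel_measurable_ereal[OF U] fm])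
    show "?A \<union> ?C \<in> events" using A C by simp
    fix \<omega> assume "\<omega> \<in> space M - (?A \<union> ?C)"
    then have "ereal (?U \<omega>) = (SUP t\<in>{0..}. ereal (p t \<omega>))"
      using p0 T by (intro trunc_sup_eq_SUP) (auto simp: not_less)
    then show "f (SUP t\<in>{0..}. ereal (p t \<omega>)) = f (ereal (?U \<omega>))" by simp
  qed (use f(2) in auto)
  also have "\<dots> \<le> 2 * B * (prob ?A + prob ?C)"
    using measure_Un_le[OF A C] f(2)[of 0] by (intro mult_left_mono) auto
  finally show ?thesis .
qed

section \<open>Restarting a Levy process\<close>

lemma levy_processD:
  assumes "levy_process M F X"
  shows "prob_space M"
    and "\<And>s t. 0 \<le> s \<Longrightarrow> s \<le> t \<Longrightarrow> subalgebra (F t) (F s)"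
    and "\<And>t. 0 \<le> t \<Longrightarrow> subalgebra M (F t)"
    and "\<And>t. 0 \<le> t \<Longrightarrow> X t \<in> borel_measurable (F t)"
    and "\<And>t. 0 \<le> t \<Longrightarrow> X t \<in> borel_measurable M"
    and "\<And>\<omega>. \<omega> \<in> space M \<Longrightarrow> X 0 \<omega> = 0"
    and "\<And>\<omega>. \<omega> \<in> space M \<Longrightarrow> is_cadlag (\<lambda>t. X t \<omega>)"
    and "\<And>\<omega>. \<omega> \<in> space M \<Longrightarrow> right_cont (\<lambda>t. X t \<omega>)"
    and "\<And>s t. 0 \<le> s \<Longrightarrow> s \<le> t \<Longrightarrow> prob_space.indep_set M (sets (F s))
          {(\<lambda>\<omega>. X t \<omega> - X s \<omega>) -` B \<inter> space M | B. B \<in> sets borel}"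
    and "\<And>s t. 0 \<le> s \<Longrightarrow> s \<le> t \<Longrightarrow>
          distr M borel (\<lambda>\<omega>. X t \<omega> - X s \<omega>) = distr M borel (X (t - s))"
proof -
  have filt: "filtration (space M) (\<lambda>t. F (max 0 t))"
    and sub: "\<And>t. t \<ge> 0 \<Longrightarrow> sets (F t) \<subseteq> sets M"
    using assms by (auto simp: levy_process_def standard_filtration_def)
  have space: "space (F t) = space M" if "t \<ge> 0" for t
    using filtration.space_F[OF filt, of t] that by simp
  show "subalgebra (F t) (F s)" if "0 \<le> s" "s \<le> t" for s t
    using filtration.sets_F_mono[OF filt, of s t] space[of s] space[of t] that
    by (simp add: subalgebra_def)
  show subM: "subalgebra M (F t)" if "0 \<le> t" for t
    using sub[OF that] space[OF that] by (simp add: subalgebra_def)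
  show meas: "X t \<in> borel_measurable (F t)" if "0 \<le> t" for t
    using assms that by (simp add: levy_process_def)
  show "X t \<in> borel_measurable M" if "0 \<le> t" for t
    by (rule measurable_from_subalg[OF subM[OF that] meas[OF that]])
  show cadlag: "is_cadlag (\<lambda>t. X t \<omega>)" if "\<omega> \<in> space M" for \<omega>
    using assms that by (simp add: levy_process_def)
  show "right_cont (\<lambda>t. X t \<omega>)" if "\<omega> \<in> space M" for \<omega>
    by (rule is_cadlag_right_cont[OF cadlag[OF that]])
qed (use assms in \<open>simp_all add: levy_process_def standard_filtration_def\<close>)

text \<open>Independence of the increment from the past sigma-algebra, as a product law for an
  arbitrary random element \<open>V\<close> of the past.\<close>

lemma distr_past_increment:
  assumes levy: "levy_process M F X" and st: "0 \<le> s" "s \<le> t"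
    and V: "V \<in> measurable (F s) S"
  shows "distr M (S \<Otimes>\<^sub>M borel) (\<lambda>\<omega>. (V \<omega>, X t \<omega> - X s \<omega>)) = distr M S V \<Otimes>\<^sub>M distr M borel (X (t - s))"
proof -
  interpret prob_space M by (rule levy_processD(1)[OF levy])
  let ?I = "\<lambda>\<omega>. X t \<omega> - X s \<omega>"
  have VM[measurable]: "V \<in> measurable M S"
    by (rule measurable_from_subalg[OF levy_processD(3)[OF levy st(1)] V])
  have IM[measurable]: "?I \<in> borel_measurable M"
    using levy_processD(5)[OF levy st(1)] levy_processD(5)[OF levy order_trans[OF st]] by measurable
  interpret V: prob_space "distr M S V" by (rule prob_space_distr[OF VM])
  interpret I: prob_space "distr M borel ?I" by (rule prob_space_distr[OF IM])
  have "distr M S V \<Otimes>\<^sub>M distr M borel ?I = distr M (S \<Otimes>\<^sub>M borel) (\<lambda>\<omega>. (V \<omega>, ?I \<omega>))"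
  proof (rule pair_measure_eqI)
    show "sigma_finite_measure (distr M S V)" "sigma_finite_measure (distr M borel ?I)"
      by unfold_locales
    show "sets (distr M S V \<Otimes>\<^sub>M distr M borel ?I) = sets (distr M (S \<Otimes>\<^sub>M borel) (\<lambda>\<omega>. (V \<omega>, ?I \<omega>)))"
      by (simp cong: sets_pair_measure_cong)
    fix A B assume "A \<in> sets (distr M S V)" "B \<in> sets (distr M borel ?I)"
    then have A: "A \<in> sets S" and B: "B \<in> sets borel" by simp_all
    have sp: "space (F s) = space M"
      using levy_processD(3)[OF levy st(1)] by (simp add: subalgebra_def)
    have "V -` A \<inter> space M \<in> sets (F s)" using measurable_sets[OF V A] by (simp add: sp)
    then have "prob ((V -` A \<inter> space M) \<inter> (?I -` B \<inter> space M)) = prob (V -` A \<inter> space M) * prob (?I -` B \<inter> space M)"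
      using B by (intro indep_setD[OF levy_processD(9)[OF levy st]]) blast+
    moreover have "(\<lambda>\<omega>. (V \<omega>, ?I \<omega>)) -` (A \<times> B) \<inter> space M = (V -` A \<inter> space M) \<inter> (?I -` B \<inter> space M)"
      by auto
    ultimately show "emeasure (distr M S V) A * emeasure (distr M borel ?I) B =
        emeasure (distr M (S \<Otimes>\<^sub>M borel) (\<lambda>\<omega>. (V \<omega>, ?I \<omega>))) (A \<times> B)"
      using A B by (simp add: emeasure_distr emeasure_eq_measure ennreal_mult)
  qed
  then show ?thesis using levy_processD(10)[OF levy st] by simp
qed

text \<open>A position together with its running maximum is a Markov chain: one step is a fixed
  function of the current pair and of an independent increment whose law is that of \<open>X h\<close>. The recursion
  for the laws thus does not involve the starting time \<open>s\<close>, and neither does its starting value.\<close>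

lemma levy_walk_distr:
  assumes levy: "levy_process M F X" and sh: "0 \<le> s" "0 \<le> h"
  shows "distr M (borel \<Otimes>\<^sub>M borel) (\<lambda>\<omega>. (X (s + real n * h) \<omega> - X s \<omega>, MAX i\<in>{..n}. X (s + real i * h) \<omega> - X s \<omega>)) =
         distr M (borel \<Otimes>\<^sub>M borel) (\<lambda>\<omega>. (X (0 + real n * h) \<omega> - X 0 \<omega>, MAX i\<in>{..n}. X (0 + real i * h) \<omega> - X 0 \<omega>))"
proof -
  interpret prob_space M by (rule levy_processD(1)[OF levy])
  define W where "W s n \<omega> = (X (s + real n * h) \<omega> - X s \<omega>, MAX i\<in>{..n}. X (s + real i * h) \<omega> - X s \<omega>)"
    for s n \<omega>
  define g :: "(real \<times> real) \<times> real \<Rightarrow> real \<times> real"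
    where "g = (\<lambda>p. (fst (fst p) + snd p, max (fst (fst p) + snd p) (snd (fst p))))"
  let ?B = "borel \<Otimes>\<^sub>M borel :: (real \<times> real) measure"
  have g[measurable]: "g \<in> measurable (?B \<Otimes>\<^sub>M borel) ?B"
    unfolding g_def by measurable
  have W_meas: "W s n \<in> measurable (F (s + real n * h)) ?B" if "s \<ge> 0" for s n
  proof -
    have X: "X u \<in> borel_measurable (F (s + real n * h))" if "0 \<le> u" "u \<le> s + real n * h" for u
      by (rule measurable_from_subalg[OF levy_processD(2)[OF levy that] levy_processD(4)[OF levy that(1)]])
    have "X (s + real i * h) \<in> borel_measurable (F (s + real n * h))" if "i \<le> n" for i
      using that \<open>s \<ge> 0\<close> sh by (intro X) (auto intro: mult_right_mono)
    moreover have "X s \<in> borel_measurable (F (s + real n * h))"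
      using \<open>s \<ge> 0\<close> sh by (intro X) auto
    ultimately show ?thesis
      unfolding W_def by (intro measurable_Pair borel_measurable_diff borel_measurable_Max) auto
  qed
  have W_step: "distr M ?B (W s (Suc n)) = distr (distr M ?B (W s n) \<Otimes>\<^sub>M distr M borel (X h)) ?B g"
    if s: "s \<ge> 0" for s n
  proof -
    let ?u = "s + real n * h" and ?v = "s + real (Suc n) * h"
    let ?I = "\<lambda>\<omega>. X ?v \<omega> - X ?u \<omega>"
    have u: "0 \<le> ?u" "?u \<le> ?v" using s sh by (auto intro: mult_right_mono)
    have WM[measurable]: "W s n \<in> measurable M ?B"
      by (rule measurable_from_subalg[OF levy_processD(3)[OF levy u(1)] W_meas[OF s]])
    have IM[measurable]: "?I \<in> borel_measurable M"
      by (intro borel_measurable_diff levy_processD(5)[OF levy] u order_trans[OF u])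
    have "W s (Suc n) = (\<lambda>\<omega>. g (W s n \<omega>, ?I \<omega>))"
      by (simp add: fun_eq_iff W_def g_def atMost_Suc del: of_nat_Suc)
    then have "distr M ?B (W s (Suc n)) = distr M ?B (\<lambda>\<omega>. g (W s n \<omega>, ?I \<omega>))"
      by (rule arg_cong[where f = "distr M ?B"])
    also have "\<dots> = distr (distr M (?B \<Otimes>\<^sub>M borel) (\<lambda>\<omega>. (W s n \<omega>, ?I \<omega>))) ?B g"
      using WM IM by (subst distr_distr) (auto simp: comp_def)
    also have "distr M (?B \<Otimes>\<^sub>M borel) (\<lambda>\<omega>. (W s n \<omega>, ?I \<omega>)) = distr M ?B (W s n) \<Otimes>\<^sub>M distr M borel (X h)"
      using distr_past_increment[OF levy u W_meas[OF s]] by (simp add: algebra_simps)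
    finally show ?thesis .
  qed
  have "distr M ?B (W s n) = distr M ?B (W 0 n)"
  proof (induction n)
    case 0
    have "W s 0 = W 0 0" by (simp add: W_def fun_eq_iff)
    then show ?case by simp
  next
    case (Suc n)
    then show ?case using W_step[of s n] W_step[of 0 n] sh by simp
  qed
  then show ?thesis unfolding W_def .
qed

text \<open>The process restarted at time \<open>s\<close> has the same law as the original one; here this is
  needed for the supremum only. It passes from grid maxima to the supremum by monotone limits.\<close>

lemma levy_restart_exceeds_le:
  assumes levy: "levy_process M F X" and s: "0 \<le> s"
  shows "measure M {\<omega>\<in>space M. \<exists>t\<ge>0. k < X (s + t) \<omega> - X s \<omega>} \<le> measure M {\<omega>\<in>space M. \<exists>t\<ge>0. k < X t \<omega>}"
proof -
  interpret prob_space M by (rule levy_processD(1)[OF levy])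
  note X = levy_processD(5)[OF levy]
  note rc = levy_processD(8)[OF levy]
  show ?thesis
  proof (rule prob_exceeds_le)
    show "(\<lambda>\<omega>. X (s + t) \<omega> - X s \<omega>) \<in> borel_measurable M" if "t \<ge> 0" for t
      using X[OF s] X[of "s + t"] that s by (intro borel_measurable_diff) auto
    show "right_cont (\<lambda>t. X (s + t) \<omega> - X s \<omega>)" if "\<omega> \<in> space M" for \<omega>
      by (rule right_cont_shift[OF rc[OF that] s])
    fix m
    define h :: real where "h = 1 / 2 ^ m"
    define n :: nat where "n = 4 ^ m"
    have h: "h \<ge> 0" by (simp add: h_def)
    define R where "R s \<omega> = (MAX i\<in>{..n}. X (s + real i * h) \<omega> - X s \<omega>)" for s \<omega>
    define W where "W s \<omega> = (X (s + real n * h) \<omega> - X s \<omega>, R s \<omega>)" for s \<omega>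
    let ?B = "borel \<Otimes>\<^sub>M borel :: (real \<times> real) measure"
    have W: "W s \<in> measurable M ?B" if "s \<ge> 0" for s
      unfolding W_def R_def using that h
      by (intro measurable_Pair borel_measurable_diff borel_measurable_Max X) auto
    have law: "distr M ?B (W s) = distr M ?B (W 0)"
      unfolding W_def R_def by (rule levy_walk_distr[OF levy s h])
    have grid: "(\<exists>q\<in>dyadic_grid m. k < X (s + q) \<omega> - X s \<omega>) \<longleftrightarrow> k < R s \<omega>" for s \<omega>
      by (simp add: R_def Max_gr_iff dyadic_grid_def h_def n_def Bex_def)
    have P: "prob {\<omega>\<in>space M. k < R s \<omega>} = measure (distr M ?B (W s)) {x. k < snd x}" if "s \<ge> 0" for s
    proof -
      have "{x\<in>space ?B. k < snd x} \<in> sets ?B" by measurable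
      then have "{x. k < snd x} \<in> sets ?B" by (simp add: space_pair_measure)
      then show ?thesis
        by (subst measure_distr[OF W[OF that]]) (auto simp: W_def intro!: arg_cong[where f = prob])
    qed
    have "prob {\<omega>\<in>space M. \<exists>q\<in>dyadic_grid m. k < X (s + q) \<omega> - X s \<omega>} =
        prob {\<omega>\<in>space M. \<exists>q\<in>dyadic_grid m. k < X (0 + q) \<omega> - X 0 \<omega>}"
      unfolding grid P[OF s] P[OF order_refl] law ..
    also have "\<dots> \<le> prob {\<omega>\<in>space M. \<exists>t\<ge>0. k < X t \<omega>}"
    proof (rule finite_measure_mono[OF _ sets_exceeds[OF X rc]])
      show "{\<omega>\<in>space M. \<exists>q\<in>dyadic_grid m. k < X (0 + q) \<omega> - X 0 \<omega>} \<subseteq> {\<omega>\<in>space M. \<exists>t\<ge>0. k < X t \<omega>}"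
        using levy_processD(6)[OF levy] dyadic_grid_nonneg by (auto; blast)
    qed
    finally show "prob {\<omega>\<in>space M. \<exists>q\<in>dyadic_grid m. k < X (s + q) \<omega> - X s \<omega>} \<le>
        prob {\<omega>\<in>space M. \<exists>t\<ge>0. k < X t \<omega>}" .
  qed
qed

text \<open>To exceed \<open>x\<close> after time \<open>s\<close>, the process must either be above \<open>x - k\<close> already at
  time \<open>s\<close> or climb by more than \<open>k\<close> afterwards; the climb is as likely as it is from time \<open>0\<close>.
  This is the estimate by which tightness of the suprema, combined with a low position at time \<open>s\<close>,
  controls the whole future.\<close>

lemma levy_tail_exceeds_le:
  assumes levy: "levy_process M F X" and s: "0 \<le> s"
  shows "measure M {\<omega>\<in>space M. \<exists>t\<ge>s. x < X t \<omega>} \<le>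
    measure M {\<omega>\<in>space M. x - k < X s \<omega>} + measure M {\<omega>\<in>space M. \<exists>t\<ge>0. k < X t \<omega>}"
proof -
  interpret prob_space M by (rule levy_processD(1)[OF levy])
  note X = levy_processD(5)[OF levy]
  note rc = levy_processD(8)[OF levy]
  let ?A = "{\<omega>\<in>space M. x - k < X s \<omega>}"
  let ?R = "{\<omega>\<in>space M. \<exists>t\<ge>0. k < X (s + t) \<omega> - X s \<omega>}"
  have A: "?A \<in> events" using X[OF s] by measurable
  have R: "?R \<in> events"
  proof (rule sets_exceeds)
    show "(\<lambda>\<omega>. X (s + t) \<omega> - X s \<omega>) \<in> borel_measurable M" if "t \<ge> 0" for t
      using X[OF s] X[of "s + t"] that s by (intro borel_measurable_diff) auto
    show "right_cont (\<lambda>t. X (s + t) \<omega> - X s \<omega>)" if "\<omega> \<in> space M" for \<omega>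
      by (rule right_cont_shift[OF rc[OF that] s])
  qed
  have "prob {\<omega>\<in>space M. \<exists>t\<ge>s. x < X t \<omega>} \<le> prob (?A \<union> ?R)"
  proof (rule finite_measure_mono)
    show "{\<omega>\<in>space M. \<exists>t\<ge>s. x < X t \<omega>} \<subseteq> ?A \<union> ?R"
    proof safe
      fix \<omega> t assume *: "\<omega> \<in> space M" "s \<le> t" "x < X t \<omega>" "\<not> (\<exists>t\<ge>0. k < X (s + t) \<omega> - X s \<omega>)"
      then have "X (s + (t - s)) \<omega> - X s \<omega> \<le> k" by (metis diff_ge_0_iff_ge not_le)
      then show "x - k < X s \<omega>" using * by simp
    qed
    show "?A \<union> ?R \<in> events" using A R by simp
  qed
  also have "\<dots> \<le> prob ?A + prob ?R" using A R by (rule measure_Un_le)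
  also have "prob ?R \<le> prob {\<omega>\<in>space M. \<exists>t\<ge>0. k < X t \<omega>}"
    by (rule levy_restart_exceeds_le[OF levy s])
  finally show ?thesis by simp
qed

text \<open>The increments change by a constant, which affects neither independence nor
  stationarity.\<close>

lemma levy_process_drift:
  assumes levy: "levy_process M F X"
  shows "levy_process M F (\<lambda>t \<omega>. X t \<omega> - c * t)"
  unfolding levy_process_def
proof (intro conjI allI impI ballI)
  show "standard_filtration M F" using levy by (simp add: levy_process_def)
  show "(\<lambda>\<omega>. X t \<omega> - c * t) \<in> borel_measurable (F t)" if "t \<ge> 0" for t
    using levy_processD(4)[OF levy that] by measurable
  show "X 0 \<omega> - c * 0 = 0" if "\<omega> \<in> space M" for \<omega>
    using levy_processD(6)[OF levy that] by simp
  show "is_cadlag (\<lambda>t. X t \<omega> - c * t)" if \<omega>: "\<omega> \<in> space M" for \<omega>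
    unfolding is_cadlag_def
  proof (intro conjI allI impI)
    fix t :: real assume "t \<ge> 0"
    then have "((\<lambda>t. X t \<omega>) \<longlongrightarrow> X t \<omega>) (at_right t)"
      using levy_processD(7)[OF levy \<omega>] by (simp add: is_cadlag_def)
    then show "((\<lambda>t. X t \<omega> - c * t) \<longlongrightarrow> X t \<omega> - c * t) (at_right t)"
      by (intro tendsto_intros)
  next
    fix t :: real assume "t > 0"
    then obtain l where "((\<lambda>t. X t \<omega>) \<longlongrightarrow> l) (at_left t)"
      using levy_processD(7)[OF levy \<omega>] by (auto simp: is_cadlag_def)
    then have "((\<lambda>t. X t \<omega> - c * t) \<longlongrightarrow> l - c * t) (at_left t)" by (intro tendsto_intros)
    then show "\<exists>l. ((\<lambda>t. X t \<omega> - c * t) \<longlongrightarrow> l) (at_left t)" ..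
  qed
  fix s t :: real assume st: "0 \<le> s \<and> s \<le> t"
  have eq: "X t \<omega> - c * t - (X s \<omega> - c * s) = (X t \<omega> - X s \<omega>) - c * (t - s)" for \<omega>
    by (simp add: algebra_simps)
  have X: "X u \<in> borel_measurable M" if "u \<ge> 0" for u
    by (rule levy_processD(5)[OF levy that])
  interpret prob_space M by (rule levy_processD(1)[OF levy])
  have sub: "{(\<lambda>\<omega>. X t \<omega> - c * t - (X s \<omega> - c * s)) -` B \<inter> space M |B. B \<in> sets borel} \<subseteq>
      {(\<lambda>\<omega>. X t \<omega> - X s \<omega>) -` B \<inter> space M |B. B \<in> sets borel}"
  proof safe
    fix B :: "real set" assume B: "B \<in> sets borel"
    have "(\<lambda>x. x - c * (t - s)) -` B \<in> sets borel"
      using measurable_sets[OF _ B, of "\<lambda>x. x - c * (t - s)" borel] by simp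
    then show "\<exists>B'. (\<lambda>\<omega>. X t \<omega> - c * t - (X s \<omega> - c * s)) -` B \<inter> space M =
        (\<lambda>\<omega>. X t \<omega> - X s \<omega>) -` B' \<inter> space M \<and> B' \<in> sets borel"
      by (intro exI[of _ "(\<lambda>x. x - c * (t - s)) -` B"]) (auto simp: eq)
  qed
  have "indep_set (sets (F s)) {(\<lambda>\<omega>. X t \<omega> - X s \<omega>) -` B \<inter> space M |B. B \<in> sets borel}"
    by (rule levy_processD(9)[OF levy]) (use st in auto)
  then show "indep_set (sets (F s)) {(\<lambda>\<omega>. X t \<omega> - c * t - (X s \<omega> - c * s)) -` B \<inter> space M |B. B \<in> sets borel}"
    unfolding indep_set_def
  proof (rule indep_sets_mono_sets)
    fix b
    show "(case b of True \<Rightarrow> sets (F s) | False \<Rightarrow> {(\<lambda>\<omega>. X t \<omega> - c * t - (X s \<omega> - c * s)) -` B \<inter> space M |B. B \<in> sets borel})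
        \<subseteq> (case b of True \<Rightarrow> sets (F s) | False \<Rightarrow> {(\<lambda>\<omega>. X t \<omega> - X s \<omega>) -` B \<inter> space M |B. B \<in> sets borel})"
      by (cases b) (simp_all only: bool.case order_refl sub)
  qed
  have "distr M borel (\<lambda>\<omega>. X t \<omega> - c * t - (X s \<omega> - c * s)) =
      distr (distr M borel (\<lambda>\<omega>. X t \<omega> - X s \<omega>)) borel (\<lambda>x. x - c * (t - s))"
    using X[of s] X[of t] st by (subst distr_distr) (auto simp: comp_def eq)
  also have "\<dots> = distr (distr M borel (X (t - s))) borel (\<lambda>x. x - c * (t - s))"
    using levy_processD(10)[OF levy, of s t] st by simp
  also have "\<dots> = distr M borel (\<lambda>\<omega>. X (t - s) \<omega> - c * (t - s))"
    using X[of "t - s"] st by (subst distr_distr) (auto simp: comp_def)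
  finally show "distr M borel (\<lambda>\<omega>. X t \<omega> - c * t - (X s \<omega> - c * s)) =
      distr M borel (\<lambda>\<omega>. X (t - s) \<omega> - c * (t - s))" .
qed

section \<open>Dispersion of nondeterministic Levy processes\<close>

text \<open>Concentration of \<open>S\<close> near \<open>y\<close> is measured by the expectation of the Gaussian bump
  \<open>exp (- ((S - y) / K)\<^sup>2 / 2)\<close>, which is at least \<open>1/2\<close> on the interval in question. The bump is a mixture
  of characters with standard normal weights, so by Fubini its expectation is a Gaussian average
  of the characteristic function of \<open>S\<close>. The centre \<open>y\<close> only contributes a phase.\<close>

lemma prob_ball_le_char:
  assumes S: "prob_space M" "S \<in> borel_measurable M" and K: "K > 0"
  shows "measure M {\<omega>\<in>space M. \<bar>S \<omega> - y\<bar> \<le> K} \<le>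
    2 * (\<integral>u. cmod (char (distr M borel S) (u / K)) \<partial>std_normal_distribution)"
proof -
  interpret prob_space M by fact
  note S(2)[measurable]
  interpret N: real_distribution std_normal_distribution by (rule real_dist_normal_dist)
  interpret P: pair_prob_space M std_normal_distribution ..
  define e where "e \<omega> u = iexp (u / K * (S \<omega> - y))" for \<omega> u
  have char_N: "(CLINT u|std_normal_distribution. e \<omega> u) = of_real (exp (- ((S \<omega> - y) / K)\<^sup>2 / 2))" for \<omega>
  proof -
    have "e \<omega> = (\<lambda>u. iexp ((S \<omega> - y) / K * u))"
      by (simp add: e_def fun_eq_iff mult.commute)
    then show ?thesis
      using fun_cong[OF char_std_normal_distribution, of "(S \<omega> - y) / K"] by (simp add: char_def)
  qed
  have meas: "case_prod e \<in> borel_measurable (M \<Otimes>\<^sub>M std_normal_distribution)"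
    unfolding e_def by measurable
  have norm_e: "cmod (e \<omega> u) = 1" for \<omega> u by (simp add: e_def flip: of_real_mult of_real_divide)
  have int: "integrable (M \<Otimes>\<^sub>M std_normal_distribution) (case_prod e)"
    using meas norm_e by (intro P.integrable_const_bound[of _ 1]) (auto intro!: always_eventually)
  have inner: "(CLINT \<omega>|M. e \<omega> u) = iexp (- (u / K * y)) * char (distr M borel S) (u / K)" for u
  proof -
    have "(CLINT \<omega>|M. e \<omega> u) = (CLINT \<omega>|M. iexp (- (u / K * y)) * iexp (u / K * S \<omega>))"
      unfolding e_def by (intro Bochner_Integration.integral_cong refl)
        (simp add: mult_exp_exp algebra_simps)
    also have "\<dots> = iexp (- (u / K * y)) * (CLINT \<omega>|M. iexp (u / K * S \<omega>))" by simp
    finally show ?thesis by (simp add: char_def integral_distr)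
  qed
  have "1 / 2 * measure M {\<omega>\<in>space M. \<bar>S \<omega> - y\<bar> \<le> K} =
      (\<integral>\<omega>. 1 / 2 * indicator {\<omega>\<in>space M. \<bar>S \<omega> - y\<bar> \<le> K} \<omega> \<partial>M)"
    by (simp add: Int_def conj_commute)
  also have "\<dots> \<le> (\<integral>\<omega>. exp (- ((S \<omega> - y) / K)\<^sup>2 / 2) \<partial>M)"
  proof (rule integral_mono)
    have "{\<omega>\<in>space M. \<bar>S \<omega> - y\<bar> \<le> K} \<in> events" by measurable
    then show "integrable M (\<lambda>\<omega>. 1 / 2 * indicat_real {\<omega>\<in>space M. \<bar>S \<omega> - y\<bar> \<le> K} \<omega>)"
      by (intro integrable_mult_right integrable_real_indicator) (auto simp: less_top[symmetric])
    show "integrable M (\<lambda>\<omega>. exp (- ((S \<omega> - y) / K)\<^sup>2 / 2))"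
      by (intro integrable_const_bound[of _ 1]) auto
    fix \<omega>
    have "1 / 2 \<le> exp (- ((S \<omega> - y) / K)\<^sup>2 / 2)" if "\<bar>S \<omega> - y\<bar> \<le> K"
    proof -
      have "\<bar>(S \<omega> - y) / K\<bar> \<le> 1" using that K by (simp add: abs_divide)
      then have "((S \<omega> - y) / K)\<^sup>2 \<le> 1" by (simp add: abs_square_le_1)
      moreover have "1 + (- ((S \<omega> - y) / K)\<^sup>2 / 2) \<le> exp (- ((S \<omega> - y) / K)\<^sup>2 / 2)"
        by (rule exp_ge_add_one_self)
      ultimately show ?thesis by linarith
    qed
    then show "1 / 2 * indicat_real {\<omega>\<in>space M. \<bar>S \<omega> - y\<bar> \<le> K} \<omega> \<le> exp (- ((S \<omega> - y) / K)\<^sup>2 / 2)"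
      by (simp add: indicator_def)
  qed
  also have "\<dots> = cmod (of_real (\<integral>\<omega>. exp (- ((S \<omega> - y) / K)\<^sup>2 / 2) \<partial>M))"
    by (simp add: integral_nonneg)
  also have "complex_of_real (\<integral>\<omega>. exp (- ((S \<omega> - y) / K)\<^sup>2 / 2) \<partial>M) =
      (CLINT \<omega>|M. CLINT u|std_normal_distribution. e \<omega> u)"
    unfolding char_N by (rule integral_complex_of_real[symmetric])
  also have "\<dots> = (CLINT u|std_normal_distribution. CLINT \<omega>|M. e \<omega> u)"
    by (rule P.Fubini_integral[OF int, symmetric])
  also have "cmod \<dots> \<le> (\<integral>u. cmod (CLINT \<omega>|M. e \<omega> u) \<partial>std_normal_distribution)"
    by (rule integral_norm_bound)
  also have "\<dots> = (\<integral>u. cmod (char (distr M borel S) (u / K)) \<partial>std_normal_distribution)"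
    unfolding inner by (simp add: norm_mult)
  finally show ?thesis by simp
qed

lemma levy_exponent_integrand_bound:
  fixes u x :: real
  shows "cmod (iexp (u * x) - 1 - \<i> * of_real (u * x * indicator {-1..1} x)) \<le> (2 + u\<^sup>2 / 2) * min 1 (x\<^sup>2)"
proof (cases "\<bar>x\<bar> \<le> 1")
  case True
  have "cmod (iexp (u * x) - (\<Sum>k\<le>1. (\<i> * (u * x)) ^ k / fact k)) \<le> \<bar>u * x\<bar> ^ Suc 1 / fact (Suc 1)"
    by (rule iexp_approx1)
  then have "cmod (iexp (u * x) - 1 - \<i> * of_real (u * x)) \<le> u\<^sup>2 / 2 * x\<^sup>2"
    by (simp add: power2_eq_square abs_mult algebra_simps)
  also have "\<dots> \<le> (2 + u\<^sup>2 / 2) * x\<^sup>2" by (intro mult_right_mono) auto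
  finally show ?thesis using True by (simp add: abs_le_iff min_absorb2 abs_square_le_1)
next
  case False
  have "1 \<le> \<bar>x\<bar>\<^sup>2" using False by (intro one_le_power) simp
  then have min: "min 1 (x\<^sup>2) = 1" by simp
  have "cmod (iexp (u * x) - 1) \<le> cmod (iexp (u * x)) + cmod 1" by (rule norm_triangle_ineq4)
  also have "\<dots> = 2" by (simp flip: of_real_mult)
  also have "\<dots> \<le> 2 + u\<^sup>2 / 2" by simp
  finally show ?thesis using False min by (auto simp: indicator_def abs_le_iff)
qed

text \<open>The real part is \<open>- \<sigma>2 * u\<^sup>2 / 2 - (\<integral>x. 1 - cos (u * x) \<partial>\<nu>)\<close>. If there is no Gaussian part, then
  \<open>\<nu>\<close> charges some punctured interval around \<open>0\<close>, and for small \<open>u\<close> the integrand is strictly positive on it.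
  Large \<open>u\<close> have to be excluded, since \<open>\<nu>\<close> may live on a lattice.\<close>

lemma Re_levy_exponent_neg:
  assumes "0 \<le> \<sigma>2" and \<nu>: "levy_measure \<nu>" and pos: "ennreal \<sigma>2 + emeasure \<nu> (UNIV - {0}) > 0"
  obtains r where "r > 0" "\<And>u. u \<noteq> 0 \<Longrightarrow> \<bar>u\<bar> < r \<Longrightarrow> Re (levy_exponent b \<sigma>2 \<nu> u) < 0"
proof -
  have sets[measurable_cong]: "sets \<nu> = sets borel" and fin: "(\<integral>\<^sup>+x. ennreal (min 1 (x\<^sup>2)) \<partial>\<nu>) < \<infinity>"
    using \<nu> by (auto simp: levy_measure_def)
  have space: "space \<nu> = UNIV" using sets_eq_imp_space_eq[OF sets] by simp
  have int_min: "integrable \<nu> (\<lambda>x. min 1 (x\<^sup>2))"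
    using fin by (intro integrableI_bounded) (auto simp: space)
  have int: "integrable \<nu> (\<lambda>x. iexp (u * x) - 1 - \<i> * of_real (u * x * indicator {-1..1} x))" for u
  proof (rule Bochner_Integration.integrable_bound)
    show "integrable \<nu> (\<lambda>x. (2 + u\<^sup>2 / 2) * min 1 (x\<^sup>2))" using int_min by simp
    show "(\<lambda>x. iexp (u * x) - 1 - \<i> * of_real (u * x * indicator {-1..1} x)) \<in> borel_measurable \<nu>"
      by measurable
    have "0 \<le> (2 + u\<^sup>2 / 2) * min 1 (x\<^sup>2)" for x by simp
    then show "AE x in \<nu>. cmod (iexp (u * x) - 1 - \<i> * of_real (u * x * indicator {-1..1} x))
        \<le> norm ((2 + u\<^sup>2 / 2) * min 1 (x\<^sup>2))"
      using levy_exponent_integrand_bound[of u] by (intro AE_I2) (simp add: abs_of_nonneg del: of_real_mult)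
  qed
  have Re_eq: "Re (levy_exponent b \<sigma>2 \<nu> u) = - (\<sigma>2 * u\<^sup>2 / 2) - (\<integral>x. 1 - cos (u * x) \<partial>\<nu>)"
    and int_cos: "integrable \<nu> (\<lambda>x. 1 - cos (u * x))" for u
  proof -
    have Re: "Re (iexp (u * x) - 1 - \<i> * of_real (u * x * indicator {-1..1} x)) = - (1 - cos (u * x))" for x
      by (simp add: Re_exp)
    have "integrable \<nu> (\<lambda>x. - (1 - cos (u * x)))"
      using integrable_Re[OF int[of u]] unfolding Re .
    then have "integrable \<nu> (\<lambda>x. - (- (1 - cos (u * x))))" by (rule Bochner_Integration.integrable_minus)
    then show "integrable \<nu> (\<lambda>x. 1 - cos (u * x))" by simp
    have "Re (CLINT x|\<nu>. iexp (u * x) - 1 - \<i> * of_real (u * x * indicator {-1..1} x)) =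
        (\<integral>x. - (1 - cos (u * x)) \<partial>\<nu>)"
      unfolding integral_Re[OF int[of u], symmetric] Re ..
    also have "\<dots> = - (\<integral>x. 1 - cos (u * x) \<partial>\<nu>)" by (rule Bochner_Integration.integral_minus)
    finally show "Re (levy_exponent b \<sigma>2 \<nu> u) = - (\<sigma>2 * u\<^sup>2 / 2) - (\<integral>x. 1 - cos (u * x) \<partial>\<nu>)"
      unfolding levy_exponent_def by simp
  qed
  have nonneg: "0 \<le> (\<integral>x. 1 - cos (u * x) \<partial>\<nu>)" for u
    by (intro Bochner_Integration.integral_nonneg) simp
  show thesis
  proof (cases "\<sigma>2 > 0")
    case True
    show thesis
    proof (rule that[of 1])
      fix u :: real assume "u \<noteq> 0"
      then have "\<sigma>2 * u\<^sup>2 > 0" using True by simp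
      then show "Re (levy_exponent b \<sigma>2 \<nu> u) < 0" unfolding Re_eq using nonneg[of u] by linarith
    qed simp
  next
    case False
    then have "emeasure \<nu> (UNIV - {0}) > 0" using pos \<open>0 \<le> \<sigma>2\<close> by simp
    define A where "A n = {x::real. x \<noteq> 0 \<and> \<bar>x\<bar> \<le> real n}" for n
    have A: "A n \<in> sets \<nu>" for n unfolding sets A_def by measurable
    have "\<exists>n. emeasure \<nu> (A n) > 0"
    proof (rule ccontr)
      assume "\<not> ?thesis"
      then have "A n \<in> null_sets \<nu>" for n using A by (auto simp: null_sets_def)
      then have "(\<Union>n. A n) \<in> null_sets \<nu>" by (rule null_sets_UN)
      moreover have "(\<Union>n. A n) = UNIV - {0}" by (auto simp: A_def real_arch_simple)
      ultimately show False using \<open>emeasure \<nu> (UNIV - {0}) > 0\<close> by (auto simp: null_sets_def)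
    qed
    then obtain n where n: "emeasure \<nu> (A n) > 0" by blast
    show thesis
    proof (rule that[of "1 / (real n + 1)"])
      fix u :: real assume u: "u \<noteq> 0" "\<bar>u\<bar> < 1 / (real n + 1)"
      have cos: "cos (u * x) < 1" if "x \<in> A n" for x
      proof -
        have "\<bar>u * x\<bar> \<le> 1 / (real n + 1) * real n"
          unfolding abs_mult using that u by (intro mult_mono) (auto simp: A_def)
        also have "\<dots> < 1" by (simp add: field_simps)
        finally have "\<bar>u * x\<bar> < 1" .
        moreover have "0 < \<bar>u * x\<bar>" using that u by (simp add: A_def)
        ultimately have "cos \<bar>u * x\<bar> < cos 0" using pi_gt3 by (intro cos_monotone_0_pi) auto
        then show ?thesis by simp
      qed
      have "(\<integral>x. 1 - cos (u * x) \<partial>\<nu>) \<noteq> 0"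
      proof
        assume "(\<integral>x. 1 - cos (u * x) \<partial>\<nu>) = 0"
        then have "AE x in \<nu>. 1 - cos (u * x) = 0"
          using integral_nonneg_eq_0_iff_AE[OF int_cos[of u]] by simp
        then have "AE x in \<nu>. x \<notin> A n" by eventually_elim (use cos in force)
        then have "A n \<in> null_sets \<nu>" using A[of n] by (simp add: AE_iff_null_sets)
        then show False using n by (auto simp: null_sets_def)
      qed
      then show "Re (levy_exponent b \<sigma>2 \<nu> u) < 0"
        unfolding Re_eq using nonneg[of u] mult_nonneg_nonneg[OF \<open>0 \<le> \<sigma>2\<close> zero_le_power2[of u]] by linarith
    qed simp
  qed
qed

text \<open>A nondeterministic process leaves every bounded region in probability, whatever the
  moving centre \<open>y n\<close>. The modulus of the characteristic function at time \<open>n\<close> is an \<open>n\<close>-th power of a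
  number below one near the origin, hence tends to zero there. After a widening of the interval, the
  Gaussian average in \<open>prob_ball_le_char\<close> puts almost all its weight on that neighbourhood.\<close>

lemma nondeterministic_disperses:
  assumes "prob_space M" and nd: "nondeterministic M X"
    and X: "\<And>t. t \<ge> 0 \<Longrightarrow> X t \<in> borel_measurable M"
  shows "(\<lambda>n::nat. measure M {\<omega>\<in>space M. \<bar>X (real n) \<omega> - y n\<bar> \<le> K}) \<longlonglongrightarrow> 0"
proof (rule tendstoI)
  fix e :: real assume e: "e > 0"
  interpret prob_space M by fact
  interpret N: real_distribution std_normal_distribution by (rule real_dist_normal_dist)
  let ?\<phi> = "\<lambda>n. char (distr M borel (X (real n)))"
  obtain b \<sigma>2 \<nu> where trip: "levy_triplet M X b \<sigma>2 \<nu>" and pos: "ennreal \<sigma>2 + emeasure \<nu> (UNIV - {0}) > 0"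
    using nd by (auto simp: nondeterministic_def)
  obtain r where r: "r > 0" "\<And>u. u \<noteq> 0 \<Longrightarrow> \<bar>u\<bar> < r \<Longrightarrow> Re (levy_exponent b \<sigma>2 \<nu> u) < 0"
    using trip pos Re_levy_exponent_neg[of \<sigma>2 \<nu> b] by (metis levy_triplet_def)
  have char: "cmod (?\<phi> n u) = exp (Re (levy_exponent b \<sigma>2 \<nu> u)) ^ n" for n u
    using trip by (simp add: levy_triplet_def exp_of_nat_mult norm_power)
  have char_le: "cmod (?\<phi> n u) \<le> 1" for n u
    by (intro real_distribution.cmod_char_le_1 real_distribution_distr X) simp
  have char_le2: "cmod (?\<phi> n u) \<le> 2" for n u using char_le[of n u] by simp
  have char_meas[measurable]: "?\<phi> n \<in> borel_measurable borel" for n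
    by (intro real_distribution.char_measurable real_distribution_distr X) simp
  have "(\<lambda>m::nat. N.prob {u. real m \<le> \<bar>u\<bar>}) \<longlonglongrightarrow> N.prob (\<Inter>m::nat. {u. real m \<le> \<bar>u\<bar>})"
    by (rule N.finite_Lim_measure_decseq) (auto simp: decseq_def)
  moreover have "(\<Inter>m::nat. {u::real. real m \<le> \<bar>u\<bar>}) = {}"
  proof (rule equals0I)
    fix u :: real assume "u \<in> (\<Inter>m::nat. {u. real m \<le> \<bar>u\<bar>})"
    moreover obtain m :: nat where "\<bar>u\<bar> < real m" using reals_Archimedean2 by blast
    ultimately show False by (simp add: not_le[symmetric])
  qed
  ultimately have "(\<lambda>m::nat. N.prob {u. real m \<le> \<bar>u\<bar>}) \<longlonglongrightarrow> 0" by simp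
  then have "\<forall>\<^sub>F m in sequentially. N.prob {u. real m \<le> \<bar>u\<bar>} < e / 4"
    using e by (intro order_tendstoD) auto
  then obtain m where m: "N.prob {u. real m \<le> \<bar>u\<bar>} < e / 4" by (auto dest: eventually_happens)
  \<comment> \<open>Wide enough that all frequencies \<open>u / K'\<close> with \<open>\<bar>u\<bar> < m\<close> lie within \<open>r\<close> of the origin.\<close>
  define K' where "K' = max (max 1 K) (real m / r)"
  have "real m / r \<le> K'" by (simp add: K'_def)
  then have "real m \<le> r * K'" using r(1) by (simp add: pos_divide_le_eq mult.commute)
  moreover have "K \<le> K'" "1 \<le> K'" by (auto simp: K'_def)
  ultimately have K': "K' \<ge> K" "K' > 0" "real m \<le> r * K'" by auto
  let ?I = "indicat_real {u. \<bar>u\<bar> < real m}"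
  have "(\<lambda>n. \<integral>u. ?I u * cmod (?\<phi> n (u / K')) \<partial>std_normal_distribution) \<longlonglongrightarrow> (\<integral>u. 0 \<partial>std_normal_distribution)"
  proof (rule integral_dominated_convergence[where w = "\<lambda>_. 1"])
    show "AE u in std_normal_distribution. (\<lambda>n. ?I u * cmod (?\<phi> n (u / K'))) \<longlonglongrightarrow> 0"
    proof -
      have "AE u in std_normal_distribution. u \<noteq> 0"
        by (subst AE_density) (auto intro: AE_lborel_singleton eventually_mono)
      then show ?thesis
      proof eventually_elim
        case (elim u)
        show ?case
        proof (cases "\<bar>u\<bar> < real m")
          case True
          then have "\<bar>u / K'\<bar> < r" using K' by (simp add: abs_divide pos_divide_less_eq)
          then have "exp (Re (levy_exponent b \<sigma>2 \<nu> (u / K'))) < 1"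
            using r(2)[of "u / K'"] elim K'(2) by simp
          then have "(\<lambda>n. cmod (?\<phi> n (u / K'))) \<longlonglongrightarrow> 0"
            unfolding char by (intro LIMSEQ_power_zero) simp
          then show ?thesis using True by simp
        qed simp
      qed
    qed
  qed (auto simp: indicator_def char_le)
  then have "\<forall>\<^sub>F n in sequentially. (\<integral>u. ?I u * cmod (?\<phi> n (u / K')) \<partial>std_normal_distribution) < e / 4"
    using e by (intro order_tendstoD) auto
  then show "\<forall>\<^sub>F n in sequentially. dist (prob {\<omega>\<in>space M. \<bar>X (real n) \<omega> - y n\<bar> \<le> K}) 0 < e"
  proof eventually_elim
    case (elim n)
    have Xn[measurable]: "X (real n) \<in> borel_measurable M" by (rule X) simp
    have "prob {\<omega>\<in>space M. \<bar>X (real n) \<omega> - y n\<bar> \<le> K} \<le> prob {\<omega>\<in>space M. \<bar>X (real n) \<omega> - y n\<bar> \<le> K'}"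
      using K' by (intro finite_measure_mono) auto
    also have "\<dots> \<le> 2 * (\<integral>u. cmod (?\<phi> n (u / K')) \<partial>std_normal_distribution)"
      by (rule prob_ball_le_char) (use K' in \<open>auto intro: prob_space_axioms\<close>)
    also have "(\<integral>u. cmod (?\<phi> n (u / K')) \<partial>std_normal_distribution) \<le>
        (\<integral>u. ?I u * cmod (?\<phi> n (u / K')) + indicator {u. real m \<le> \<bar>u\<bar>} u \<partial>std_normal_distribution)"
      by (rule integral_mono)
        (auto intro!: N.integrable_const_bound[of _ 2] simp: indicator_def char_le char_le2)
    also have "\<dots> = (\<integral>u. ?I u * cmod (?\<phi> n (u / K')) \<partial>std_normal_distribution) + N.prob {u. real m \<le> \<bar>u\<bar>}"
      by (subst Bochner_Integration.integral_add)
        (auto intro!: N.integrable_const_bound[of _ 1] simp: indicator_def char_le)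
    finally show ?case using elim m by (simp add: dist_real_def)
  qed
qed

text \<open>The position leaves every bounded region in probability, but cannot leave upwards
  because the supremum is tight. So it must leave downwards.\<close>

lemma levy_drifts_to_minus_infinity:
  assumes levy: "levy_process M F X"
    and disp: "\<And>K. (\<lambda>n::nat. measure M {\<omega>\<in>space M. \<bar>X (real n) \<omega>\<bar> \<le> K}) \<longlonglongrightarrow> 0"
    and sup: "\<And>\<delta>. \<delta> > 0 \<Longrightarrow> \<exists>\<kappa>. measure M {\<omega>\<in>space M. \<exists>t\<ge>0. \<kappa> < X t \<omega>} \<le> \<delta>"
  shows "(\<lambda>n::nat. measure M {\<omega>\<in>space M. y < X (real n) \<omega>}) \<longlonglongrightarrow> 0"
proof (rule tendstoI)
  fix e :: real assume e: "e > 0"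
  interpret prob_space M by (rule levy_processD(1)[OF levy])
  obtain \<kappa> where \<kappa>: "prob {\<omega>\<in>space M. \<exists>t\<ge>0. \<kappa> < X t \<omega>} \<le> e / 2" using sup[of "e / 2"] e by auto
  define K where "K = max \<kappa> (- y)"
  have exc: "{\<omega>\<in>space M. \<exists>t\<ge>0. \<kappa> < X t \<omega>} \<in> events"
    by (rule sets_exceeds[OF levy_processD(5,8)[OF levy]])
  have "\<forall>\<^sub>F n in sequentially. prob {\<omega>\<in>space M. \<bar>X (real n) \<omega>\<bar> \<le> K} < e / 2"
    using disp[of K] e by (intro order_tendstoD) auto
  then show "\<forall>\<^sub>F n in sequentially. dist (prob {\<omega>\<in>space M. y < X (real n) \<omega>}) 0 < e"
  proof eventually_elim
    case (elim n)
    have [measurable]: "X (real n) \<in> borel_measurable M" by (rule levy_processD(5)[OF levy]) simp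
    have ball: "{\<omega>\<in>space M. \<bar>X (real n) \<omega>\<bar> \<le> K} \<in> events" by measurable
    have "prob {\<omega>\<in>space M. y < X (real n) \<omega>} \<le>
        prob ({\<omega>\<in>space M. \<bar>X (real n) \<omega>\<bar> \<le> K} \<union> {\<omega>\<in>space M. \<exists>t\<ge>0. \<kappa> < X t \<omega>})"
    proof (rule finite_measure_mono)
      show "{\<omega>\<in>space M. y < X (real n) \<omega>} \<subseteq>
          {\<omega>\<in>space M. \<bar>X (real n) \<omega>\<bar> \<le> K} \<union> {\<omega>\<in>space M. \<exists>t\<ge>0. \<kappa> < X t \<omega>}"
      proof safe
        fix \<omega> assume "y < X (real n) \<omega>" "\<not> (\<exists>t\<ge>0. \<kappa> < X t \<omega>)"
        then have "y < X (real n) \<omega>" "X (real n) \<omega> \<le> \<kappa>" by (auto simp: not_less)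
        then show "\<bar>X (real n) \<omega>\<bar> \<le> K" by (auto simp: K_def)
      qed
    qed (use ball exc in simp)
    also have "\<dots> \<le> prob {\<omega>\<in>space M. \<bar>X (real n) \<omega>\<bar> \<le> K} + prob {\<omega>\<in>space M. \<exists>t\<ge>0. \<kappa> < X t \<omega>}"
      by (rule measure_Un_le[OF ball exc])
    finally show ?case using elim \<kappa> by (simp add: dist_real_def)
  qed
qed

section \<open>Convergence of the all-time supremum\<close>

lemma is_cadlag_rescale:
  assumes x: "is_cadlag x" and c: "c > 0"
  shows "is_cadlag (\<lambda>t. k * (x (c * t) - t * m))"
  unfolding is_cadlag_def
proof (intro conjI allI impI)
  fix t :: real assume "t \<ge> 0"
  then have "(x \<longlongrightarrow> x (c * t)) (at_right (c * t))" using x c by (simp add: is_cadlag_def)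
  moreover have "filterlim (\<lambda>t. c * t) (at_right (c * t)) (at_right t)"
    using c by (auto simp: filterlim_at eventually_at_filter intro!: tendsto_eq_intros)
  ultimately have "((\<lambda>t. x (c * t)) \<longlongrightarrow> x (c * t)) (at_right t)" by (rule filterlim_compose)
  then show "((\<lambda>t. k * (x (c * t) - t * m)) \<longlongrightarrow> k * (x (c * t) - t * m)) (at_right t)"
    by (intro tendsto_intros)
next
  fix t :: real assume "t > 0"
  then have "c * t > 0" using c by simp
  then obtain l where "(x \<longlongrightarrow> l) (at_left (c * t))" using x unfolding is_cadlag_def by blast
  moreover have "filterlim (\<lambda>t. c * t) (at_left (c * t)) (at_left t)"
    using c by (auto simp: filterlim_at eventually_at_filter intro!: tendsto_eq_intros)
  ultimately have "((\<lambda>t. x (c * t)) \<longlongrightarrow> l) (at_left t)" by (rule filterlim_compose)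
  then have "((\<lambda>t. k * (x (c * t) - t * m)) \<longlongrightarrow> k * (l - t * m)) (at_left t)" by (intro tendsto_intros)
  then show "\<exists>l. ((\<lambda>t. k * (x (c * t) - t * m)) \<longlongrightarrow> l) (at_left t)" ..
qed

lemma exceeds_rescale:
  fixes k c T y :: real
  assumes "k > 0" "c > 0"
  shows "(\<exists>t\<ge>T. y < k * x (c * t)) \<longleftrightarrow> (\<exists>t\<ge>c * T. y / k < x t)"
proof
  assume "\<exists>t\<ge>T. y < k * x (c * t)"
  then obtain t where "t \<ge> T" "y < k * x (c * t)" by blast
  then show "\<exists>t\<ge>c * T. y / k < x t"
    using assms by (intro exI[of _ "c * t"]) (simp add: pos_divide_less_eq mult.commute)
next
  assume "\<exists>t\<ge>c * T. y / k < x t"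
  then obtain t where "t \<ge> c * T" "y / k < x t" by blast
  then show "\<exists>t\<ge>T. y < k * x (c * t)"
    using assms by (intro exI[of _ "t / c"]) (simp add: pos_divide_less_eq pos_le_divide_eq mult.commute)
qed

lemma SUP_rescale:
  fixes k c :: real
  assumes "k > 0" "c > 0"
  shows "ereal k * (SUP t\<in>{0..}. ereal (x t)) = (SUP t\<in>{0..}. ereal (k * x (c * t)))"
proof -
  have "ereal k * (SUP t\<in>{0..}. ereal (x t)) = (SUP t\<in>{0..}. ereal k * ereal (x t))"
    using assms by (subst Sup_ereal_mult_left') auto
  also have "\<dots> = (SUP t\<in>(\<lambda>t. c * t) ` {0..}. ereal (k * x t))"
  proof -
    have "(\<lambda>t. c * t) ` {0..} = {0..}"
    proof (intro equalityI subsetI)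
      fix t :: real assume "t \<in> {0..}"
      then show "t \<in> (\<lambda>t. c * t) ` {0..}" using assms by (intro image_eqI[of _ _ "t / c"]) auto
    qed (use assms in auto)
    then show ?thesis by simp
  qed
  finally show ?thesis by (simp add: image_image)
qed

theorem proposition3:
  fixes M :: "real \<Rightarrow> 'a measure" and F :: "real \<Rightarrow> real \<Rightarrow> 'a measure"
    and X :: "real \<Rightarrow> real \<Rightarrow> 'a \<Rightarrow> real"
    and N :: "'b measure" and G :: "real \<Rightarrow> 'b measure"
    and Z :: "real \<Rightarrow> 'b \<Rightarrow> real"
    and \<mu> d \<Delta> :: "real \<Rightarrow> real" and \<beta> :: real
  assumes levy: "\<And>a. a > 0 \<Longrightarrow> levy_process (M a) (F a) (X a)"
    and nondet: "\<And>a. a > 0 \<Longrightarrow> nondeterministic (M a) (X a)"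
    and integrable: "\<And>a. a > 0 \<Longrightarrow> integrable (M a) (X a 1)"
    and mean: "\<And>a. a > 0 \<Longrightarrow> \<mu> a = (\<integral>\<omega>. X a 1 \<omega> \<partial>M a)"
    and mean_neg: "\<And>a. a > 0 \<Longrightarrow> \<mu> a < 0"
    and mean_lim: "(\<mu> \<longlongrightarrow> 0) (at_right 0)"
    and d_pos: "\<And>a. a > 0 \<Longrightarrow> d a > 0"
    and Delta_pos: "\<And>a. a > 0 \<Longrightarrow> \<Delta> a > 0"
    and beta_pos: "\<beta> > 0"
    and I: "((\<lambda>a. d a * \<Delta> a * \<bar>\<mu> a\<bar>) \<longlongrightarrow> \<beta>) (at_right 0)"
    and levy_lim: "levy_process N G Z"
    and nondet_lim: "nondeterministic N Z"
    and II: "conv_in_dist M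
               (\<lambda>a \<omega>. cadlag_of (\<lambda>t. \<Delta> a * (X a (d a * t) \<omega> - t * d a * \<mu> a)))
               N (\<lambda>\<omega>. cadlag_of (\<lambda>t. Z t \<omega>)) (at_right 0)"
    and III: "tight_family {0<..} M
               (\<lambda>a \<omega>. ereal (\<Delta> a) * (SUP t\<in>{0..}. ereal (X a t \<omega>)))"
  shows "(AE \<omega> in N. (SUP t\<in>{0..}. ereal (Z t \<omega> - \<beta> * t)) < \<infinity>) \<and>
         conv_in_dist M
           (\<lambda>a \<omega>. ereal (\<Delta> a) * (SUP t\<in>{0..}. ereal (X a t \<omega>)))
           N (\<lambda>\<omega>. SUP t\<in>{0..}. ereal (Z t \<omega> - \<beta> * t)) (at_right 0)"
proof -
  define p where "p a t \<omega> = \<Delta> a * X a (d a * t) \<omega>" for a t \<omega>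
  define q where "q t \<omega> = Z t \<omega> - \<beta> * t" for t \<omega>
  have pos: "\<forall>\<^sub>F a::real in at_right 0. a > 0" by (rule eventually_at_right_less)
  have prob_M: "prob_space (M a)" if "a > 0" for a by (rule levy_processD(1)[OF levy[OF that]])
  have ev_prob_M: "\<forall>\<^sub>F a in at_right 0. prob_space (M a)"
    using pos by eventually_elim (rule prob_M)
  have levy_q: "levy_process N G q"
    unfolding q_def by (rule levy_process_drift[OF levy_lim])
  interpret N: prob_space N by (rule levy_processD(1)[OF levy_lim])
  note q_meas = levy_processD(5)[OF levy_q] and q_rc = levy_processD(8)[OF levy_q]

  have p_meas: "p a t \<in> borel_measurable (M a)" if "a > 0" "t \<ge> 0" for a t
    unfolding p_def using levy_processD(5)[OF levy[OF that(1)], of "d a * t"] d_pos[OF that(1)] that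
    by (intro borel_measurable_times borel_measurable_const) auto
  have p_rc: "right_cont (\<lambda>t. p a t \<omega>)" if "a > 0" "\<omega> \<in> space (M a)" for a \<omega>
    using is_cadlag_right_cont[OF is_cadlag_rescale[OF levy_processD(7)[OF levy[OF that(1)] that(2)] d_pos[OF that(1)],
      of "\<Delta> a" 0]] by (simp add: p_def)
  have p0: "p a 0 \<omega> = 0" if "a > 0" "\<omega> \<in> space (M a)" for a \<omega>
    using levy_processD(6)[OF levy[OF that(1)] that(2)] by (simp add: p_def)
  have p_sup: "ereal (\<Delta> a) * (SUP t\<in>{0..}. ereal (X a t \<omega>)) = (SUP t\<in>{0..}. ereal (p a t \<omega>))"
    if "a > 0" for a \<omega>
    unfolding p_def by (rule SUP_rescale[OF Delta_pos[OF that] d_pos[OF that]])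
  have p_exc: "{\<omega>\<in>space (M a). \<exists>t\<ge>T. y < p a t \<omega>} =
      {\<omega>\<in>space (M a). \<exists>t\<ge>d a * T. y / \<Delta> a < X a t \<omega>}" if "a > 0" for a T y
  proof (intro Collect_cong conj_cong refl)
    show "(\<exists>t\<ge>T. y < p a t \<omega>) \<longleftrightarrow> (\<exists>t\<ge>d a * T. y / \<Delta> a < X a t \<omega>)" for \<omega>
      unfolding p_def by (rule exceeds_rescale[OF Delta_pos[OF that] d_pos[OF that], where x = "\<lambda>t. X a t \<omega>"])
  qed

  \<comment> \<open>The process \<open>X a\<close> itself is the one that is Levy for a filtration at hand, so thresholds and
    times are rescaled instead of the process.\<close>
  have p_tail: "measure (M a) {\<omega>\<in>space (M a). \<exists>t\<ge>T. 0 < p a t \<omega>} \<le>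
      measure (M a) {\<omega>\<in>space (M a). - \<kappa> < p a T \<omega>} + measure (M a) {\<omega>\<in>space (M a). \<exists>t\<ge>0. \<kappa> < p a t \<omega>}"
    if a: "a > 0" and T: "T \<ge> 0" for a T \<kappa>
  proof -
    have "0 \<le> d a * T" using d_pos[OF a] T by simp
    from levy_tail_exceeds_le[OF levy[OF a] this, of 0 "\<kappa> / \<Delta> a"]
    have "measure (M a) {\<omega>\<in>space (M a). \<exists>t\<ge>T. 0 < p a t \<omega>} \<le>
      measure (M a) {\<omega>\<in>space (M a). 0 - \<kappa> / \<Delta> a < X a (d a * T) \<omega>} +
      measure (M a) {\<omega>\<in>space (M a). \<exists>t\<ge>0. \<kappa> < p a t \<omega>}"
      unfolding p_exc[OF a] by simp
    moreover have "- \<kappa> < p a T \<omega> \<longleftrightarrow> 0 - \<kappa> / \<Delta> a < X a (d a * T) \<omega>" for \<omega>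
      using pos_divide_less_eq[OF Delta_pos[OF a], of "- \<kappa>"] by (simp add: p_def mult.commute)
    ultimately show ?thesis by simp
  qed

  have p_tight: "\<exists>\<kappa>\<ge>0. \<forall>a>0. measure (M a) {\<omega>\<in>space (M a). \<exists>t\<ge>0. \<kappa> < p a t \<omega>} \<le> \<delta>" if "\<delta> > 0" for \<delta>
  proof -
    obtain K where "\<forall>a\<in>{0<..}. 1 - \<delta> \<le> measure (M a)
        {\<omega>\<in>space (M a). \<bar>ereal (\<Delta> a) * (SUP t\<in>{0..}. ereal (X a t \<omega>))\<bar> \<le> ereal K}"
      using III \<open>\<delta> > 0\<close> unfolding tight_family_def by blast
    then have K: "1 - \<delta> \<le> measure (M a) {\<omega>\<in>space (M a). \<bar>SUP t\<in>{0..}. ereal (p a t \<omega>)\<bar> \<le> ereal K}"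
      if "a > 0" for a
      using that by (simp add: p_sup)
    show ?thesis
    proof (intro exI[of _ "max 0 K"] conjI allI impI)
      fix a :: real assume a: "a > 0"
      interpret prob_space "M a" by (rule prob_M[OF a])
      let ?S = "\<lambda>\<omega>. SUP t\<in>{0..}. ereal (p a t \<omega>)"
      have [measurable]: "?S \<in> borel_measurable (M a)"
        by (rule borel_measurable_SUP_right_cont[OF p_meas p_rc]) (use a in auto)
      have B: "{\<omega>\<in>space (M a). \<bar>?S \<omega>\<bar> \<le> ereal K} \<in> events" by measurable
      have "prob {\<omega>\<in>space (M a). \<exists>t\<ge>0. max 0 K < p a t \<omega>} \<le> prob (space (M a) - {\<omega>\<in>space (M a). \<bar>?S \<omega>\<bar> \<le> ereal K})"
      proof (rule finite_measure_mono)
        show "{\<omega>\<in>space (M a). \<exists>t\<ge>0. max 0 K < p a t \<omega>} \<subseteq> space (M a) - {\<omega>\<in>space (M a). \<bar>?S \<omega>\<bar> \<le> ereal K}"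
        proof safe
          fix \<omega> t assume "(0::real) \<le> t" "max 0 K < p a t \<omega>" "\<bar>?S \<omega>\<bar> \<le> ereal K"
          have "ereal (p a t \<omega>) \<le> ?S \<omega>" using \<open>0 \<le> t\<close> by (intro SUP_upper) auto
          also have "\<dots> \<le> \<bar>?S \<omega>\<bar>" by (cases "?S \<omega>") auto
          also have "\<dots> \<le> ereal K" by fact
          finally show False using \<open>max 0 K < _\<close> by simp
        qed
      qed (use B in simp)
      also have "\<dots> = 1 - prob {\<omega>\<in>space (M a). \<bar>?S \<omega>\<bar> \<le> ereal K}" by (rule prob_compl[OF B])
      finally show "prob {\<omega>\<in>space (M a). \<exists>t\<ge>0. max 0 K < p a t \<omega>} \<le> \<delta>" using K[OF a] by simp
    qed simp
  qed

  \<comment> \<open>The slope \<open>d a * \<Delta> a * \<bar>\<mu> a\<bar>\<close> turns the centred process of the functional limit theorem into \<open>p\<close>.\<close>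
  have trunc_conv: "conv_in_dist M (\<lambda>a \<omega>. trunc_sup l w (\<lambda>t. p a t \<omega>)) N (\<lambda>\<omega>. trunc_sup l w (\<lambda>t. q t \<omega>)) (at_right 0)"
    if w: "ceiling_profile l w" for l w
  proof (rule conv_in_dist_cong[OF conv_in_dist_trunc_sup[OF w ev_prob_M II I]])
    show "\<forall>\<^sub>F a in at_right 0. \<forall>\<omega>\<in>space (M a).
        trunc_sup l w (\<lambda>t. path (cadlag_of (\<lambda>t. \<Delta> a * (X a (d a * t) \<omega> - t * d a * \<mu> a))) t - d a * \<Delta> a * \<bar>\<mu> a\<bar> * t) =
        trunc_sup l w (\<lambda>t. p a t \<omega>)"
      using pos
    proof eventually_elim
      case (elim a)
      show ?case
      proof (intro ballI trunc_sup_cong)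
        fix \<omega> t assume \<omega>: "\<omega> \<in> space (M a)" and t: "t \<ge> (0::real)"
        have "is_cadlag (\<lambda>t. \<Delta> a * (X a (d a * t) \<omega> - t * d a * \<mu> a))"
          using is_cadlag_rescale[OF levy_processD(7)[OF levy[OF elim] \<omega>] d_pos[OF elim], of "\<Delta> a" "d a * \<mu> a"]
          by (simp add: mult.assoc)
        then show "path (cadlag_of (\<lambda>t. \<Delta> a * (X a (d a * t) \<omega> - t * d a * \<mu> a))) t - d a * \<Delta> a * \<bar>\<mu> a\<bar> * t = p a t \<omega>"
          using t mean_neg[OF elim] by (simp add: path_cadlag_of p_def algebra_simps)
      qed
    qed
    fix \<omega> assume "\<omega> \<in> space N"
    then show "trunc_sup l w (\<lambda>t. path (cadlag_of (\<lambda>t. Z t \<omega>)) t - \<beta> * t) = trunc_sup l w (\<lambda>t. q t \<omega>)"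
      using levy_processD(7)[OF levy_lim] by (intro trunc_sup_cong) (simp add: path_cadlag_of q_def)
  qed

  \<comment> \<open>Tightness passes to the limit: a clipped supremum of \<open>q\<close> is a limit in distribution of ones
    of \<open>p\<close>, which are dominated by the all-time suprema.\<close>
  have q_tight: "\<exists>\<kappa>. measure N {\<omega>\<in>space N. \<exists>t\<ge>0. \<kappa> < q t \<omega>} \<le> \<delta>" if "\<delta> > 0" for \<delta>
  proof -
    obtain K where K: "K \<ge> 0" "\<And>a. a > 0 \<Longrightarrow> measure (M a) {\<omega>\<in>space (M a). \<exists>t\<ge>0. K < p a t \<omega>} \<le> \<delta> / 2"
      using p_tight[of "\<delta> / 2"] \<open>\<delta> > 0\<close> by auto
    have "measure N {\<omega>\<in>space N. \<exists>t\<ge>0. K + 1 < q t \<omega>} \<le> \<delta>"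
    proof (rule N.prob_exceeds_le[OF q_meas q_rc])
      fix m
      \<comment> \<open>High enough, \<open>K + 2\<close>, not to clip below the level \<open>K + 1\<close>; the gap down to \<open>K\<close> separates the
        thresholds in the passage to the limit.\<close>
      let ?w = "\<lambda>t. (K + 2) - max 0 (max (0 - t) (t - 2 ^ m))"
      let ?U = "\<lambda>a \<omega>. trunc_sup 0 ?w (\<lambda>t. p a t \<omega>)" and ?V = "\<lambda>\<omega>. trunc_sup 0 ?w (\<lambda>t. q t \<omega>)"
      have w: "ceiling_profile 0 ?w" by (rule ceiling_profileI) simp
      note conv = trunc_conv[OF w]
      have [measurable]: "?V \<in> borel_measurable N" using conv by (simp add: conv_in_dist_def)
      have "measure N {\<omega>\<in>space N. \<exists>t\<in>dyadic_grid m. K + 1 < q t \<omega>} \<le> measure N {\<omega>\<in>space N. K + 1 \<le> ?V \<omega>}"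
      proof (rule N.finite_measure_mono)
        show "{\<omega>\<in>space N. \<exists>t\<in>dyadic_grid m. K + 1 < q t \<omega>} \<subseteq> {\<omega>\<in>space N. K + 1 \<le> ?V \<omega>}"
        proof safe
          fix \<omega> t assume t: "t \<in> dyadic_grid m" "K + 1 < q t \<omega>"
          then have "?w t = K + 2"
            using dyadic_grid_nonneg[OF t(1)] dyadic_grid_le[OF t(1)] by simp
          then have "K + 1 \<le> max 0 (min (q t \<omega>) (?w t))" using t by simp
          also have "\<dots> \<le> ?V \<omega>" by (rule trunc_sup_upper[OF w dyadic_grid_nonneg[OF t(1)]])
          finally show "K + 1 \<le> ?V \<omega>" .
        qed
      qed measurable
      moreover have "\<forall>\<^sub>F a in at_right 0. measure N {\<omega>\<in>space N. K + 1 \<le> ?V \<omega>} \<le>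
          measure (M a) {\<omega>\<in>space (M a). K < ?U a \<omega>} + \<delta> / 2"
        by (rule conv_in_dist_eventually_prob_le(2)[OF conv ev_prob_M N.prob_space_axioms])
          (use \<open>\<delta> > 0\<close> in auto)
      then have "\<exists>a>0. measure N {\<omega>\<in>space N. K + 1 \<le> ?V \<omega>} \<le>
          measure (M a) {\<omega>\<in>space (M a). K < ?U a \<omega>} + \<delta> / 2"
        using pos by (metis (mono_tags, lifting) eventually_conj eventually_happens' trivial_limit_at_right_real)
      then obtain a where a: "a > 0" "measure N {\<omega>\<in>space N. K + 1 \<le> ?V \<omega>} \<le>
          measure (M a) {\<omega>\<in>space (M a). K < ?U a \<omega>} + \<delta> / 2"
        by blast
      interpret prob_space "M a" by (rule prob_M[OF a(1)])
      have "prob {\<omega>\<in>space (M a). K < ?U a \<omega>} \<le> prob {\<omega>\<in>space (M a). \<exists>t\<ge>0. K < p a t \<omega>}"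
        by (rule finite_measure_mono[OF _ sets_exceeds[OF p_meas[OF a(1)] p_rc[OF a(1)]]])
          (use less_trunc_supD[OF _ K(1)] in blast)
      with K(2)[OF a(1)] a(2)
      have "measure N {\<omega>\<in>space N. K + 1 \<le> ?V \<omega>} \<le> \<delta>" by linarith
      ultimately show "measure N {\<omega>\<in>space N. \<exists>t\<in>dyadic_grid m. K + 1 < q t \<omega>} \<le> \<delta>" by linarith
    qed
    then show ?thesis ..
  qed

  have q_drift: "(\<lambda>n::nat. measure N {\<omega>\<in>space N. y < q (real n) \<omega>}) \<longlonglongrightarrow> 0" for y
  proof (rule levy_drifts_to_minus_infinity[OF levy_q _ q_tight])
    show "(\<lambda>n. N.prob {\<omega>\<in>space N. \<bar>q (real n) \<omega>\<bar> \<le> K}) \<longlonglongrightarrow> 0" for K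
      unfolding q_def by (rule nondeterministic_disperses[OF N.prob_space_axioms nondet_lim levy_processD(5)[OF levy_lim]])
  qed

  have finite_sup: "AE \<omega> in N. (SUP t\<in>{0..}. ereal (q t \<omega>)) < \<infinity>"
  proof -
    let ?E = "{\<omega>\<in>space N. \<not> (SUP t\<in>{0..}. ereal (q t \<omega>)) < \<infinity>}"
    have [measurable]: "(\<lambda>\<omega>. SUP t\<in>{0..}. ereal (q t \<omega>)) \<in> borel_measurable N"
      by (rule borel_measurable_SUP_right_cont[OF q_meas q_rc])
    have E: "?E \<in> sets N" by measurable
    have "N.prob ?E \<le> 0"
    proof (rule field_le_epsilon)
      fix \<delta> :: real assume "\<delta> > 0"
      then obtain \<kappa> where \<kappa>: "N.prob {\<omega>\<in>space N. \<exists>t\<ge>0. \<kappa> < q t \<omega>} \<le> \<delta>" using q_tight by blast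
      have "N.prob ?E \<le> N.prob {\<omega>\<in>space N. \<exists>t\<ge>0. \<kappa> < q t \<omega>}"
      proof (rule N.finite_measure_mono[OF _ sets_exceeds[OF q_meas q_rc]])
        show "?E \<subseteq> {\<omega>\<in>space N. \<exists>t\<ge>0. \<kappa> < q t \<omega>}"
        proof safe
          fix \<omega> assume "\<not> (SUP t\<in>{0..}. ereal (q t \<omega>)) < \<infinity>"
          then have "ereal \<kappa> < (SUP t\<in>{0..}. ereal (q t \<omega>))" by simp
          then show "\<exists>t\<ge>0. \<kappa> < q t \<omega>" by (auto simp: less_SUP_iff)
        qed
      qed
      with \<kappa> show "N.prob ?E \<le> 0 + \<delta>" by simp
    qed
    then have "?E \<in> null_sets N" using E by (simp add: null_sets_def N.emeasure_eq_measure measure_le_0_iff)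
    then show ?thesis by (rule AE_I') simp
  qed

  have "conv_in_dist M (\<lambda>a \<omega>. ereal (\<Delta> a) * (SUP t\<in>{0..}. ereal (X a t \<omega>)))
      N (\<lambda>\<omega>. SUP t\<in>{0..}. ereal (q t \<omega>)) (at_right 0)"
    unfolding conv_in_dist_def
  proof (intro conjI allI impI)
    show "\<forall>\<^sub>F a in at_right 0. (\<lambda>\<omega>. ereal (\<Delta> a) * (SUP t\<in>{0..}. ereal (X a t \<omega>))) \<in> borel_measurable (M a)"
      using pos
    proof eventually_elim
      case (elim a)
      show ?case unfolding p_sup[OF elim]
        by (rule borel_measurable_SUP_right_cont[OF p_meas[OF elim] p_rc[OF elim]])
    qed
    show "(\<lambda>\<omega>. SUP t\<in>{0..}. ereal (q t \<omega>)) \<in> borel_measurable N"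
      by (rule borel_measurable_SUP_right_cont[OF q_meas q_rc])
    fix f :: "ereal \<Rightarrow> real" assume f: "continuous_on UNIV f \<and> bounded (range f)"
    obtain B where B: "B > 0" "\<And>x. \<bar>f x\<bar> \<le> B" using f by (auto simp: bounded_pos)
    show "((\<lambda>a. \<integral>\<omega>. f (ereal (\<Delta> a) * (SUP t\<in>{0..}. ereal (X a t \<omega>))) \<partial>M a) \<longlongrightarrow>
        (\<integral>\<omega>. f (SUP t\<in>{0..}. ereal (q t \<omega>)) \<partial>N)) (at_right 0)"
    proof (rule tendstoI)
      fix e :: real assume e: "e > 0"
      \<comment> \<open>Bad events of probability at most \<open>5 * \<delta>\<close> for \<open>p\<close> and \<open>3 * \<delta>\<close> for \<open>q\<close> will cost \<open>16 * B * \<delta>\<close> in total.\<close>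
      define \<delta> where "\<delta> = e / (40 * B)"
      have \<delta>: "\<delta> > 0" "16 * (B * \<delta>) < e / 2" using e B(1) by (auto simp: \<delta>_def)
      obtain \<kappa>1 where \<kappa>1: "\<kappa>1 \<ge> 0" "\<And>a. a > 0 \<Longrightarrow> measure (M a) {\<omega>\<in>space (M a). \<exists>t\<ge>0. \<kappa>1 < p a t \<omega>} \<le> \<delta>"
        using p_tight[OF \<delta>(1)] by auto
      obtain \<kappa>2 where \<kappa>2: "N.prob {\<omega>\<in>space N. \<exists>t\<ge>0. \<kappa>2 < q t \<omega>} \<le> \<delta>"
        using q_tight[OF \<delta>(1)] by auto
      define \<kappa> where "\<kappa> = max \<kappa>1 \<kappa>2"
      have p_exceed: "measure (M a) {\<omega>\<in>space (M a). \<exists>t\<ge>0. \<kappa> < p a t \<omega>} \<le> \<delta>" if "a > 0" for a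
      proof -
        interpret prob_space "M a" by (rule prob_M[OF that])
        have "prob {\<omega>\<in>space (M a). \<exists>t\<ge>0. \<kappa> < p a t \<omega>} \<le> prob {\<omega>\<in>space (M a). \<exists>t\<ge>0. \<kappa>1 < p a t \<omega>}"
          by (rule finite_measure_mono[OF _ sets_exceeds[OF p_meas[OF that] p_rc[OF that]]]) (auto simp: \<kappa>_def)
        with \<kappa>1(2)[OF that] show ?thesis by simp
      qed
      have q_exceed: "N.prob {\<omega>\<in>space N. \<exists>t\<ge>0. \<kappa> < q t \<omega>} \<le> \<delta>"
      proof -
        have "N.prob {\<omega>\<in>space N. \<exists>t\<ge>0. \<kappa> < q t \<omega>} \<le> N.prob {\<omega>\<in>space N. \<exists>t\<ge>0. \<kappa>2 < q t \<omega>}"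
          by (rule N.finite_measure_mono[OF _ sets_exceeds[OF q_meas q_rc]]) (auto simp: \<kappa>_def)
        with \<kappa>2 show ?thesis by simp
      qed
      have "\<forall>\<^sub>F n in sequentially. N.prob {\<omega>\<in>space N. - \<kappa> - 1 - \<kappa> < q (real n) \<omega>} < \<delta>"
        using q_drift \<delta>(1) by (rule order_tendstoD)
      then obtain S :: nat where S: "N.prob {\<omega>\<in>space N. - \<kappa> - 1 - \<kappa> < q (real S) \<omega>} < \<delta>"
        by (auto dest: eventually_happens)
      \<comment> \<open>One time unit after \<open>S\<close>: a cap that peaks at \<open>T\<close> and falls by less than one sees only times after \<open>S\<close>.\<close>
      define T where "T = real S + 1"
      have T: "T \<ge> 0" by (simp add: T_def)
      have q_window: "N.prob {\<omega>\<in>space N. \<exists>t\<ge>real S. - \<kappa> - 1 < q t \<omega>} \<le> 2 * \<delta>"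
        using levy_tail_exceeds_le[OF levy_q of_nat_0_le_iff, of S "- \<kappa> - 1" \<kappa>] S q_exceed by linarith
      have q_window_sets: "{\<omega>\<in>space N. \<exists>t\<ge>real S. - \<kappa> - 1 < q t \<omega>} \<in> sets N"
        by (rule sets_exceeds_after[OF q_meas q_rc]) auto
      have q_tail: "N.prob {\<omega>\<in>space N. \<exists>t\<ge>T. 0 < q t \<omega>} \<le> 2 * \<delta>"
      proof -
        have "N.prob {\<omega>\<in>space N. \<exists>t\<ge>T. 0 < q t \<omega>} \<le> N.prob {\<omega>\<in>space N. \<exists>t\<ge>real S. - \<kappa> - 1 < q t \<omega>}"
        proof (rule N.finite_measure_mono[OF _ q_window_sets])
          show "{\<omega>\<in>space N. \<exists>t\<ge>T. 0 < q t \<omega>} \<subseteq> {\<omega>\<in>space N. \<exists>t\<ge>real S. - \<kappa> - 1 < q t \<omega>}"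
          proof safe
            fix \<omega> t assume "T \<le> t" "0 < q t \<omega>"
            then show "\<exists>t\<ge>real S. - \<kappa> - 1 < q t \<omega>"
              using \<kappa>1(1) by (intro exI[of _ t]) (auto simp: T_def \<kappa>_def)
          qed
        qed
        with q_window show ?thesis by simp
      qed

      \<comment> \<open>Evaluation at the fixed time \<open>T\<close> is not continuous on the path space. A cap that peaks at \<open>T\<close>
        provides a continuous functional that is at least \<open>- \<kappa>\<close> when \<open>p a T\<close> exceeds \<open>- \<kappa>\<close>.\<close>
      let ?w2 = "\<lambda>t. - \<kappa> - max 0 (max (T - t) (t - T))"
      let ?U2 = "\<lambda>a \<omega>. trunc_sup (- \<kappa> - 2) ?w2 (\<lambda>t. p a t \<omega>)"
      let ?V2 = "\<lambda>\<omega>. trunc_sup (- \<kappa> - 2) ?w2 (\<lambda>t. q t \<omega>)"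
      have w2: "ceiling_profile (- \<kappa> - 2) ?w2" by (rule ceiling_profileI) simp
      note conv2 = trunc_conv[OF w2]
      have "N.prob {\<omega>\<in>space N. - \<kappa> - 1 < ?V2 \<omega>} \<le> N.prob {\<omega>\<in>space N. \<exists>t\<ge>real S. - \<kappa> - 1 < q t \<omega>}"
      proof (rule N.finite_measure_mono[OF _ q_window_sets])
        show "{\<omega>\<in>space N. - \<kappa> - 1 < ?V2 \<omega>} \<subseteq> {\<omega>\<in>space N. \<exists>t\<ge>real S. - \<kappa> - 1 < q t \<omega>}"
        proof safe
          fix \<omega> assume "- \<kappa> - 1 < ?V2 \<omega>"
          then obtain t where t: "- \<kappa> - 1 < q t \<omega>" "- \<kappa> - 1 < ?w2 t"
            using less_trunc_supD[of "- \<kappa> - 1" "- \<kappa> - 2" ?w2 "\<lambda>t. q t \<omega>"] by auto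
          then show "\<exists>t\<ge>real S. - \<kappa> - 1 < q t \<omega>"
            by (intro exI[of _ t]) (auto simp: T_def)
        qed
      qed
      then have V2: "N.prob {\<omega>\<in>space N. - \<kappa> - 1 < ?V2 \<omega>} \<le> 2 * \<delta>" using q_window by simp
      have ev_U2: "\<forall>\<^sub>F a in at_right 0. measure (M a) {\<omega>\<in>space (M a). - \<kappa> \<le> ?U2 a \<omega>} \<le>
          N.prob {\<omega>\<in>space N. - \<kappa> - 1 < ?V2 \<omega>} + \<delta>"
        by (rule conv_in_dist_eventually_prob_le(1)[OF conv2 ev_prob_M N.prob_space_axioms])
          (use \<delta>(1) in auto)
      have ev_U2_meas: "\<forall>\<^sub>F a in at_right 0. ?U2 a \<in> borel_measurable (M a)"
        using conv2 by (simp add: conv_in_dist_def)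

      \<comment> \<open>The cap for the window \<open>[0, T]\<close>, whose clipped supremum stands in for the all-time supremum.\<close>
      let ?w = "\<lambda>t. \<kappa> - max 0 (max (0 - t) (t - T))"
      let ?U = "\<lambda>a \<omega>. trunc_sup 0 ?w (\<lambda>t. p a t \<omega>)"
      let ?V = "\<lambda>\<omega>. trunc_sup 0 ?w (\<lambda>t. q t \<omega>)"
      have w: "ceiling_profile 0 ?w" by (rule ceiling_profileI[OF T])
      note conv = trunc_conv[OF w]
      have V_meas: "?V \<in> borel_measurable N"
        and ev_U_meas: "\<forall>\<^sub>F a in at_right 0. ?U a \<in> borel_measurable (M a)"
        using conv by (simp_all add: conv_in_dist_def)
      have "continuous_on UNIV (\<lambda>x. f (ereal x))"
        using f by (intro continuous_on_compose2[of UNIV f UNIV ereal] continuous_on_ereal continuous_on_id) auto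
      moreover have "bounded (range (\<lambda>x. f (ereal x)))" using B by (auto simp: bounded_iff)
      ultimately have "((\<lambda>a. \<integral>\<omega>. f (ereal (?U a \<omega>)) \<partial>M a) \<longlongrightarrow> (\<integral>\<omega>. f (ereal (?V \<omega>)) \<partial>N)) (at_right 0)"
        using conv unfolding conv_in_dist_def by blast
      then have ev_lim: "\<forall>\<^sub>F a in at_right 0. dist (\<integral>\<omega>. f (ereal (?U a \<omega>)) \<partial>M a) (\<integral>\<omega>. f (ereal (?V \<omega>)) \<partial>N) < e / 2"
        using e by (intro tendstoD) auto
      have V_approx: "\<bar>(\<integral>\<omega>. f (SUP t\<in>{0..}. ereal (q t \<omega>)) \<partial>N) - (\<integral>\<omega>. f (ereal (?V \<omega>)) \<partial>N)\<bar> \<le> 2 * B * (\<delta> + 2 * \<delta>)"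
      proof (rule order_trans[OF N.expectation_SUP_approx[OF q_meas q_rc _ _ _ T V_meas]])
        show "2 * B * (N.prob {\<omega>\<in>space N. \<exists>t\<ge>0. \<kappa> < q t \<omega>} + N.prob {\<omega>\<in>space N. \<exists>t\<ge>T. 0 < q t \<omega>})
            \<le> 2 * B * (\<delta> + 2 * \<delta>)"
          using B(1) q_exceed q_tail by (intro mult_left_mono add_mono) auto
      qed (use f B levy_processD(6)[OF levy_q] in auto)
      show "\<forall>\<^sub>F a in at_right 0. dist (\<integral>\<omega>. f (ereal (\<Delta> a) * (SUP t\<in>{0..}. ereal (X a t \<omega>))) \<partial>M a)
          (\<integral>\<omega>. f (SUP t\<in>{0..}. ereal (q t \<omega>)) \<partial>N) < e"
        using pos ev_U2 ev_U2_meas ev_U_meas ev_lim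
      proof eventually_elim
        case (elim a)
        note a = elim(1)
        interpret prob_space "M a" by (rule prob_M[OF a])
        note [measurable] = elim(3)
        have "prob {\<omega>\<in>space (M a). - \<kappa> < p a T \<omega>} \<le> prob {\<omega>\<in>space (M a). - \<kappa> \<le> ?U2 a \<omega>}"
        proof (rule finite_measure_mono)
          show "{\<omega>\<in>space (M a). - \<kappa> < p a T \<omega>} \<subseteq> {\<omega>\<in>space (M a). - \<kappa> \<le> ?U2 a \<omega>}"
          proof safe
            fix \<omega> assume "- \<kappa> < p a T \<omega>"
            then have "- \<kappa> \<le> max (- \<kappa> - 2) (min (p a T \<omega>) (?w2 T))" by simp
            also have "\<dots> \<le> ?U2 a \<omega>" by (rule trunc_sup_upper[OF w2 T])
            finally show "- \<kappa> \<le> ?U2 a \<omega>" .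
          qed
        qed measurable
        then have p_tail_le: "prob {\<omega>\<in>space (M a). \<exists>t\<ge>T. 0 < p a t \<omega>} \<le> 4 * \<delta>"
          using p_tail[OF a T, of \<kappa>] p_exceed[OF a] V2 elim(2) by linarith
        have "\<bar>(\<integral>\<omega>. f (SUP t\<in>{0..}. ereal (p a t \<omega>)) \<partial>M a) - (\<integral>\<omega>. f (ereal (?U a \<omega>)) \<partial>M a)\<bar> \<le> 2 * B * (\<delta> + 4 * \<delta>)"
        proof (rule order_trans[OF expectation_SUP_approx[OF p_meas[OF a] p_rc[OF a] _ _ _ T elim(4)]])
          show "2 * B * (prob {\<omega>\<in>space (M a). \<exists>t\<ge>0. \<kappa> < p a t \<omega>} + prob {\<omega>\<in>space (M a). \<exists>t\<ge>T. 0 < p a t \<omega>})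
              \<le> 2 * B * (\<delta> + 4 * \<delta>)"
            using B(1) p_exceed[OF a] p_tail_le by (intro mult_left_mono add_mono) auto
        qed (use f B p0[OF a] in auto)
        moreover have "2 * B * (\<delta> + 4 * \<delta>) + 2 * B * (\<delta> + 2 * \<delta>) = 16 * (B * \<delta>)"
          by (simp add: algebra_simps)
        ultimately show ?case
          using V_approx elim(5) \<delta>(2) unfolding p_sup[OF a] dist_real_def by linarith
      qed
    qed
  qed
  with finite_sup show ?thesis unfolding q_def by blast
qed

end
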